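(* Let $f\colon(\mathbb{C}^2,0)\to(\mathbb{C}^3,0)$ be a fold surface, $f(x,y)=(x,y^2,y\,p(x,y^2))$, and let $\check f(x,y)=(x,y^2,y^3p(x,y^2))$ be its frontalisation. Then there is an isomorphism (of $\mathbb{C}$-vector spaces) $$\frac{\theta(f)}{T\mathscr{A}_ef}\cong\frac{\mathscr{F}(\check f)}{T\mathscr{A}_e\check f}.$$ In particular, $f$ is $\mathscr{A}$-finite if and only if $\check f$ is $\mathscr{F}$-finite, and $\operatorname{codim}_{\mathscr{A}}(f)=\operatorname{codim}_{\mathscr{F}}(\check f)$.
   Context: All maps are holomorphic germs. $\theta_n$ denotes the module of germs of vector fields on $(\mathbb{C}^n,0)$. For a germ $g\colon(\mathbb{C}^n,0)\to(\mathbb{C}^{n+1},0)$, $\theta(g)$ is the module of germs of vector fields along $g$ (identified with $\mathscr{O}_n^{n+1}$), and $T\mathscr{A}_eg=\{dg\circ\xi+\eta\circ g:\xi\in\theta_n,\ \eta\in\theta_{n+1}\}\subseteq\theta(g)$. The $\mathscr{A}$-codimension is $\operatorname{codim}_{\mathscr{A}}(g)=\dim_{\mathbb{C}}\theta(g)/T\mathscr{A}_eg$, and $g$ is $\mathscr{A}$-finite if this is finite. A holomorphic map $g\colon N\subset\mathbb{C}^n\to\mathbb{C}^{n+1}$ is frontal if there is a nowhere-vanishing holomorphic $1$-form $\nu=\sum_{i=1}^{n+1}\nu_i\,dX_i$ along $g$ (the $\nu_i$ are holomorphic functions on $N$ with no common zero) such that $\nu(dg\circ\xi)=0$ for all vector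 fields $\xi$ on $N$; a germ is frontal if it has a frontal representative. All frontals are assumed generically immersive (immersive on a dense open set). For a frontal germ $g$, $$\mathscr{F}(g)=\left\{\left.\tfrac{dg_t}{dt}\right|_{t=0}: g_0=g,\ (g_t,t)\text{ frontal}\right\}\subseteq\theta(g),$$ where $(g_t,t)$ ranges over holomorphic $1$-parameter unfoldings of $g$ that are frontal. One has $T\mathscr{A}_eg\subseteq\mathscr{F}(g)$. The frontal codimension is $\operatorname{codim}_{\mathscr{F}}(g)=\dim_{\mathbb{C}}\mathscr{F}(g)/T\mathscr{A}_eg$, and $g$ is $\mathscr{F}$-finite if this is finite. *)

theory Defs
  imports
    "HOL-Complex_Analysis.Complex_Analysis"
    "HOL-Library.Extended_Nat"
    "HOL-Algebra.AbelCoset"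
    "Jordan_Normal_Form.Missing_VectorSpace"
begin

section \<open>Holomorphic maps in several variables\<close>

text \<open>
  A function of several complex variables is holomorphic if it is Frechet differentiable
  with complex linear derivative at every point, and a map into complex affine space is
  holomorphic if its components are.
\<close>

definition holo_fun :: "(complex^'n \<Rightarrow> complex) \<Rightarrow> (complex^'n) set \<Rightarrow> bool" where
  "holo_fun h U \<longleftrightarrow>
     (\<forall>x\<in>U. \<exists>a :: complex^'n. (h has_derivative (\<lambda>v. \<Sum>i\<in>UNIV. a $ i * v $ i)) (at x))"

definition holo_map :: "(complex^'n \<Rightarrow> complex^'m) \<Rightarrow> (complex^'n) set \<Rightarrow> bool" where
  "holo_map h U \<longleftrightarrow> (\<forall>i. holo_fun (\<lambda>x. h x $ i) U)"

definition holo_fun_germ :: "(complex^'n \<Rightarrow> complex) \<Rightarrow> bool" where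
  "holo_fun_germ h \<longleftrightarrow> (\<exists>U. open U \<and> 0 \<in> U \<and> holo_fun h U)"

definition holo_map_germ :: "(complex^'n \<Rightarrow> complex^'m) \<Rightarrow> bool" where
  "holo_map_germ h \<longleftrightarrow> (\<exists>U. open U \<and> 0 \<in> U \<and> holo_map h U)"


section \<open>Germs at the origin\<close>

quotient_type (overloaded) ('n, 'm) germ = "complex^('n::finite) \<Rightarrow> complex^('m::finite)" /
    "\<lambda>h k. \<forall>\<^sub>F x in nhds 0. h x = k x"
  morphisms rep_germ germ_of
proof (rule equivpI)
  show "reflp (\<lambda>h k :: complex^'n \<Rightarrow> complex^'m. \<forall>\<^sub>F x in nhds 0. h x = k x)"
    by (simp add: reflp_def)
  show "symp (\<lambda>h k :: complex^'n \<Rightarrow> complex^'m. \<forall>\<^sub>F x in nhds 0. h x = k x)"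
    by (simp add: symp_def eq_commute)
  show "transp (\<lambda>h k :: complex^'n \<Rightarrow> complex^'m. \<forall>\<^sub>F x in nhds 0. h x = k x)"
    by (auto simp: transp_def elim: eventually_elim2)
qed

instantiation germ :: (finite, finite) ab_group_add
begin

lift_definition zero_germ :: "('a, 'b) germ" is "\<lambda>_. 0" .

lift_definition plus_germ :: "('a, 'b) germ \<Rightarrow> ('a, 'b) germ \<Rightarrow> ('a, 'b) germ"
  is "\<lambda>h k x. h x + k x"
  by (auto elim: eventually_elim2)

lift_definition uminus_germ :: "('a, 'b) germ \<Rightarrow> ('a, 'b) germ" is "\<lambda>h x. - h x"
  by (auto elim: eventually_mono)

lift_definition minus_germ :: "('a, 'b) germ \<Rightarrow> ('a, 'b) germ \<Rightarrow> ('a, 'b) germ"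
  is "\<lambda>h k x. h x - k x"
  by (auto elim: eventually_elim2)

instance
  by standard (transfer; simp add: algebra_simps)+

end

lift_definition scale_germ :: "complex \<Rightarrow> ('n::finite, 'm::finite) germ \<Rightarrow> ('n, 'm) germ"
  is "\<lambda>c h x. c *s h x"
  by (auto elim: eventually_mono)


section \<open>Quotient vector spaces\<close>

text \<open>
  The space of cosets of \<open>W\<close> in \<open>V\<close>. The scalar multiple of the coset of \<open>x\<close> by
  \<open>c\<close> is the coset of \<open>c \<odot> x\<close>; the ring multiplication of the module record plays no role.
\<close>

definition quotient_space ::
    "('a, 'v) module \<Rightarrow> 'v set \<Rightarrow> ('a, 'v set) module" where
  "quotient_space V W =
     \<lparr>carrier = a_rcosets\<^bsub>V\<^esub> W,
      mult = (\<lambda>_ _. W),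
      one = W,
      zero = W,
      add = (\<lambda>A B. A <+>\<^bsub>V\<^esub> B),
      smult = (\<lambda>c A. \<Union>x\<in>A. W +>\<^bsub>V\<^esub> (c \<odot>\<^bsub>V\<^esub> x))\<rparr>"

definition dim_ext :: "('a, 'c) ring_scheme \<Rightarrow> ('a, 'v) module \<Rightarrow> enat" where
  "dim_ext K V = (if vectorspace.fin_dim K V then enat (vectorspace.dim K V) else \<infinity>)"

definition isomorphic_spaces ::
    "('a, 'c) ring_scheme \<Rightarrow> ('a, 'v) module \<Rightarrow> ('a, 'w) module \<Rightarrow> bool" where
  "isomorphic_spaces K V W \<longleftrightarrow>
     (\<exists>\<phi>. linear_map K V W \<phi> \<and> bij_betw \<phi> (carrier V) (carrier W))"

definition complex_field :: "complex ring" where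
  "complex_field = \<lparr>carrier = UNIV, mult = (*), one = 1, zero = 0, add = (+)\<rparr>"


section \<open>Vector fields along a germ and the extended tangent space\<close>

text \<open>
  Vector fields along \<open>g\<close> are identified with their component maps, so \<open>\<theta>(g)\<close> depends on
  \<open>g\<close> only through the dimensions. Map germs are given by representatives;
  all notions below depend on the germ only.
\<close>

definition theta ::
    "(complex^'n \<Rightarrow> complex^'m) \<Rightarrow> (complex, ('n::finite, 'm::finite) germ) module" where
  "theta g =
     \<lparr>carrier = {germ_of h | h. holo_map_germ h},
      mult = (\<lambda>_ _. 0), one = 0, zero = 0, add = (+), smult = scale_germ\<rparr>"

definition TAe :: "(complex^'n \<Rightarrow> complex^'m) \<Rightarrow> ('n::finite, 'm::finite) germ set" where
  "TAe g = {germ_of (\<lambda>x. frechet_derivative g (at x) (\<xi> x) + \<eta> (g x)) | \<xi> \<eta>.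
              holo_map_germ \<xi> \<and> holo_map_germ \<eta>}"

definition A_quotient ::
    "(complex^'n \<Rightarrow> complex^'m) \<Rightarrow> (complex, ('n::finite, 'm::finite) germ set) module" where
  "A_quotient g = quotient_space (theta g) (TAe g)"

definition codim_A :: "(complex^'n::finite \<Rightarrow> complex^'m::finite) \<Rightarrow> enat" where
  "codim_A g = dim_ext complex_field (A_quotient g)"

definition A_finite :: "(complex^'n::finite \<Rightarrow> complex^'m::finite) \<Rightarrow> bool" where
  "A_finite g \<longleftrightarrow> codim_A g < \<infinity>"


section \<open>Frontals\<close>

text \<open>
  The notions are only used for hypersurface dimensions, that is, when the target has
  one dimension more than the source. The 1-form \<open>\<nu>\<close> along \<open>g\<close> is given by its
  coefficients \<open>\<nu> x $ i\<close>.
\<close>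

definition generically_immersive_on ::
    "(complex^'n \<Rightarrow> complex^'m) \<Rightarrow> (complex^'n) set \<Rightarrow> bool" where
  "generically_immersive_on g U \<longleftrightarrow>
     (\<exists>D. open D \<and> D \<subseteq> U \<and> U \<subseteq> closure D \<and> (\<forall>x\<in>D. inj (frechet_derivative g (at x))))"

definition frontal_on :: "(complex^'n \<Rightarrow> complex^'m) \<Rightarrow> (complex^'n) set \<Rightarrow> bool" where
  "frontal_on g U \<longleftrightarrow>
     holo_map g U \<and> generically_immersive_on g U \<and>
     (\<exists>\<nu> :: complex^'n \<Rightarrow> complex^'m. holo_map \<nu> U \<and> (\<forall>x\<in>U. \<nu> x \<noteq> 0) \<and>
        (\<forall>\<xi>. holo_map \<xi> U \<longrightarrow>
           (\<forall>x\<in>U. (\<Sum>i\<in>UNIV. \<nu> x $ i * frechet_derivative g (at x) (\<xi> x) $ i) = 0)))"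

definition frontal_germ :: "(complex^'n \<Rightarrow> complex^'m) \<Rightarrow> bool" where
  "frontal_germ g \<longleftrightarrow> (\<exists>U. open U \<and> 0 \<in> U \<and> frontal_on g U)"

text \<open>
  The map \<open>(x, t) \<mapsto> (g\<^sub>t x, t)\<close>. The index type \<open>'n option\<close> adds one coordinate,
  labelled \<^term>\<open>None\<close>, to those labelled by \<open>'n\<close>; it carries the parameter \<open>t\<close>.
\<close>

definition unfolding_map ::
    "(complex \<Rightarrow> complex^'n \<Rightarrow> complex^'m) \<Rightarrow>
     complex^('n option) \<Rightarrow> complex^('m option)" where
  "unfolding_map G w =
     (\<chi> j. case j of None \<Rightarrow> w $ None
                   | Some i \<Rightarrow> G (w $ None) (\<chi> k. w $ Some k) $ i)"

text \<open>
  Unfoldings are not required to preserve the origin, \<open>g\<^sub>t 0\<close> may be nonzero for \<open>t \<noteq> 0\<close>.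
\<close>

definition frontal_deformations ::
    "(complex^'n \<Rightarrow> complex^'m) \<Rightarrow> ('n::finite, 'm::finite) germ set" where
  "frontal_deformations g =
     {germ_of (\<lambda>x. \<chi> i. deriv (\<lambda>t. G t x $ i) 0) | G.
        (\<forall>\<^sub>F x in nhds 0. G 0 x = g x) \<and> frontal_germ (unfolding_map G)}"

definition F_quotient ::
    "(complex^'n \<Rightarrow> complex^'m) \<Rightarrow> (complex, ('n::finite, 'm::finite) germ set) module" where
  "F_quotient g = quotient_space ((theta g)\<lparr>carrier := frontal_deformations g\<rparr>) (TAe g)"

definition codim_F :: "(complex^'n::finite \<Rightarrow> complex^'m::finite) \<Rightarrow> enat" where
  "codim_F g = dim_ext complex_field (F_quotient g)"

definition F_finite :: "(complex^'n::finite \<Rightarrow> complex^'m::finite) \<Rightarrow> bool" where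
  "F_finite g \<longleftrightarrow> codim_F g < \<infinity>"


section \<open>Fold surfaces\<close>

definition fold_surface :: "(complex^2 \<Rightarrow> complex) \<Rightarrow> complex^2 \<Rightarrow> complex^3" where
  "fold_surface p v =
     (let x = v $ 1; y = v $ 2 in vector [x, y^2, y * p (vector [x, y^2])])"

definition fold_frontalisation :: "(complex^2 \<Rightarrow> complex) \<Rightarrow> complex^2 \<Rightarrow> complex^3" where
  "fold_frontalisation p v =
     (let x = v $ 1; y = v $ 2 in vector [x, y^2, y^3 * p (vector [x, y^2])])"

end

theory Submission
  imports Defs
begin

text \<open>
  The fold surface and its frontalisation are the members \<open>k = 0\<close> and \<open>k = 1\<close> of the family
  \<open>f\<^sub>k(x,y) = (x, y^2, y^(2k+1) p(x,y^2))\<close>. The proof rests on the fact that every function germ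
  in the plane splits as \<open>c(x,y) = c0(x,y^2) + y c1(x,y^2)\<close>, with unique germs \<open>c0\<close> and \<open>c1\<close>
  (\<open>even_odd_decomposition\<close>).

  Tangent spaces. Functions on the target pull back under \<open>f\<^sub>k\<close> to the functions
  \<open>a(x,y^2) + y^(2k+1) p(x,y^2) b(x,y^2)\<close> with \<open>a\<close> and \<open>b\<close> arbitrary. Splitting all ingredients of
  \<open>df\<^sub>k \<circ> \<xi> + \<eta> \<circ> f\<^sub>k\<close> into even and odd parts shows that the first two components of such a field, and
  the even part of the third, can be prescribed freely, while the odd part of the third is
  \<open>y^(2k+1) c1(x,y^2)\<close> with \<open>c1\<close> ranging over the ideal generated by \<open>p_X\<close>, \<open>p\<close> and \<open>Y p_Y\<close>
  (\<open>TAe_fold_map_subset\<close>, \<open>TAe_fold_map_superset\<close>). The ideal is the same for all \<open>k\<close>: although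
  \<open>\<partial>f\<^sub>k/\<partial>y\<close> involves the combination \<open>(2k+1) p + 2 Y p_Y\<close>, the term \<open>p\<close> alone is supplied by \<open>\<eta>\<close>.

  Frontal deformations. For a frontal unfolding \<open>f_t\<close> of \<open>f\<^sub>1\<close> with conormal form \<open>\<nu>\<close>, the components
  \<open>\<nu>\<^sub>1\<close> and \<open>\<nu>\<^sub>2\<close> vanish on \<open>y = t = 0\<close>, and so does \<open>\<partial>f\<^sub>1/\<partial>y\<close>; differentiating
  \<open>\<nu>(\<partial>f_t/\<partial>y) = 0\<close> in \<open>t\<close> therefore leaves \<open>\<nu>\<^sub>3 \<partial>z\<^sub>3/\<partial>y = 0\<close> for the velocity field \<open>z\<close>. So the odd
  part of \<open>z\<^sub>3\<close> is divisible by \<open>y^3\<close> (\<open>frontal_deformations_subset\<close>). Conversely every such field is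
  the velocity of \<open>H_t \<circ> \<Phi>_t\<close> for diffeomorphisms \<open>\<Phi>_t\<close> of the plane and maps \<open>H_t\<close> whose
  \<open>y\<close>-derivative is divisible by \<open>y\<close>; such compositions are frontal
  (\<open>frontal_family\<close>, \<open>frontal_deformations_superset\<close>).

  The isomorphism. By these descriptions the linear injection \<open>(a, b, c0 + y c1) \<mapsto> (a, b, c0 + y^3 c1)\<close>
  maps \<open>\<theta>(f\<^sub>0)\<close> onto the space of frontal deformations of \<open>f\<^sub>1\<close> and the tangent space of \<open>f\<^sub>0\<close> onto that
  of \<open>f\<^sub>1\<close> (\<open>twist_odd_part_odd_part_space\<close>), so it induces the isomorphism of quotients.

  Complex analysis enters through one tool: the integral of a holomorphic family over a circle is
  holomorphic in the parameter (\<open>cdiff_integral\<close>). Through Cauchy's formula it yields that partial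
  derivatives are holomorphic and commute, Hadamard's lemma, and the even-odd decomposition.
\<close>

(* Leaves the infix for vector components as its only reading. *)
no_notation fps_nth (infixl "$" 75)

section \<open>Complex differentiability and partial derivatives\<close>

text \<open>
  Differentiability is stated at a single point, so that a function germ is holomorphic if and only
  if it is differentiable at all points that are eventually close to the origin. Facts about germs
  then combine by the calculus of filters, without choosing neighbourhoods.
\<close>

definition cdiff_at :: "(complex^'n \<Rightarrow> complex) \<Rightarrow> complex^'n \<Rightarrow> bool" where
  "cdiff_at h x \<longleftrightarrow> (\<exists>a :: complex^'n. (h has_derivative (\<lambda>v. \<Sum>i\<in>UNIV. a $ i * v $ i)) (at x))"

definition partial_deriv :: "'n \<Rightarrow> (complex^'n \<Rightarrow> complex) \<Rightarrow> complex^'n \<Rightarrow> complex" where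
  "partial_deriv i h x = frechet_derivative h (at x) (axis i 1)"

lemma holo_fun_iff_cdiff: "holo_fun h U \<longleftrightarrow> (\<forall>x\<in>U. cdiff_at h x)"
  by (simp add: holo_fun_def cdiff_at_def)

lemma has_derivative_imp_partial_deriv:
  fixes a :: "'n::finite \<Rightarrow> complex"
  assumes "(h has_derivative (\<lambda>v. \<Sum>i\<in>UNIV. a i * v $ i)) (at x)"
  shows "cdiff_at h x" and "partial_deriv i h x = a i"
proof -
  show "cdiff_at h x" unfolding cdiff_at_def using assms by (intro exI[of _ "\<chi> i. a i"]) simp
  have "frechet_derivative h (at x) = (\<lambda>v. \<Sum>i\<in>UNIV. a i * v $ i)"
    using frechet_derivative_at[OF assms] by simp
  then show "partial_deriv i h x = a i"
    by (simp add: partial_deriv_def axis_def if_distrib cong: if_cong)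
qed

lemma cdiff_has_derivative:
  assumes "cdiff_at h x"
  shows "(h has_derivative (\<lambda>v. \<Sum>i\<in>UNIV. partial_deriv i h x * v $ i)) (at x)"
proof -
  from assms obtain a where a: "(h has_derivative (\<lambda>v. \<Sum>i\<in>UNIV. a $ i * v $ i)) (at x)"
    by (auto simp: cdiff_at_def)
  show ?thesis using a has_derivative_imp_partial_deriv(2)[OF a] by simp
qed

lemma cdiff_continuous: "cdiff_at h x \<Longrightarrow> isCont h x"
  using cdiff_has_derivative has_derivative_continuous by blast

lemma cdiff_transform:
  assumes "cdiff_at h x" "\<forall>\<^sub>F y in nhds x. h y = k y"
  shows "cdiff_at k x" "partial_deriv i k x = partial_deriv i h x"
proof -
  have "\<forall>\<^sub>F y in at x. h y = k y"
    using assms(2) by (auto simp: eventually_at_filter elim!: eventually_mono)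
  from has_derivative_transform_eventually[OF cdiff_has_derivative[OF assms(1)] this
      eventually_nhds_x_imp_x[OF assms(2)]]
  have "(k has_derivative (\<lambda>v. \<Sum>i\<in>UNIV. partial_deriv i h x * v $ i)) (at x)" by simp
  from has_derivative_imp_partial_deriv[OF this] show "cdiff_at k x" "partial_deriv i k x = partial_deriv i h x" .
qed

lemma partial_deriv_cong: "\<forall>\<^sub>F y in nhds x. h y = k y \<Longrightarrow> cdiff_at h x \<Longrightarrow> partial_deriv i h x = partial_deriv i k x"
  using cdiff_transform(2) by metis

lemma partial_deriv_const [simp]: "partial_deriv i (\<lambda>_. c) x = 0" and cdiff_const [simp]: "cdiff_at (\<lambda>_. c) x"
  using has_derivative_imp_partial_deriv[of "\<lambda>_. c" "\<lambda>_. 0" x] by simp_all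

lemma partial_deriv_coord: "partial_deriv i (\<lambda>w. w $ j) x = (if i = j then 1 else 0)"
  and cdiff_coord [simp]: "cdiff_at (\<lambda>w. w $ j) x"
proof -
  have "((\<lambda>w. w $ j) has_derivative (\<lambda>v. \<Sum>i\<in>UNIV. (if i = j then 1 else 0) * v $ i)) (at x)"
    by (simp add: if_distrib[of "\<lambda>x. x * _"] cong: if_cong)
       (rule bounded_linear_imp_has_derivative, rule bounded_linear_vec_nth)
  from has_derivative_imp_partial_deriv[OF this]
  show "partial_deriv i (\<lambda>w. w $ j) x = (if i = j then 1 else 0)" "cdiff_at (\<lambda>w. w $ j) x" by auto
qed

lemma
  assumes "cdiff_at h x" "cdiff_at k x"
  shows cdiff_add [simp]: "cdiff_at (\<lambda>w. h w + k w) x"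
    and partial_deriv_add: "partial_deriv i (\<lambda>w. h w + k w) x = partial_deriv i h x + partial_deriv i k x"
    and cdiff_diff [simp]: "cdiff_at (\<lambda>w. h w - k w) x"
    and partial_deriv_diff: "partial_deriv i (\<lambda>w. h w - k w) x = partial_deriv i h x - partial_deriv i k x"
    and cdiff_mult [simp]: "cdiff_at (\<lambda>w. h w * k w) x"
    and partial_deriv_mult: "partial_deriv i (\<lambda>w. h w * k w) x = h x * partial_deriv i k x + partial_deriv i h x * k x"
proof -
  note D = cdiff_has_derivative[OF assms(1)] cdiff_has_derivative[OF assms(2)]
  have "((\<lambda>w. h w + k w) has_derivative (\<lambda>v. \<Sum>i\<in>UNIV. (partial_deriv i h x + partial_deriv i k x) * v $ i)) (at x)"
    using has_derivative_add[OF D] by (simp add: algebra_simps sum.distrib)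
  from has_derivative_imp_partial_deriv[OF this]
  show "cdiff_at (\<lambda>w. h w + k w) x" "partial_deriv i (\<lambda>w. h w + k w) x = partial_deriv i h x + partial_deriv i k x" .
  have "((\<lambda>w. h w - k w) has_derivative (\<lambda>v. \<Sum>i\<in>UNIV. (partial_deriv i h x - partial_deriv i k x) * v $ i)) (at x)"
    using has_derivative_diff[OF D] by (simp add: algebra_simps sum_subtractf)
  from has_derivative_imp_partial_deriv[OF this]
  show "cdiff_at (\<lambda>w. h w - k w) x" "partial_deriv i (\<lambda>w. h w - k w) x = partial_deriv i h x - partial_deriv i k x" .
  have "((\<lambda>w. h w * k w) has_derivative (\<lambda>v. \<Sum>i\<in>UNIV. (h x * partial_deriv i k x + partial_deriv i h x * k x) * v $ i)) (at x)"
    using has_derivative_mult[OF D] by (simp add: algebra_simps sum.distrib sum_distrib_left)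
  from has_derivative_imp_partial_deriv[OF this]
  show "cdiff_at (\<lambda>w. h w * k w) x" "partial_deriv i (\<lambda>w. h w * k w) x = h x * partial_deriv i k x + partial_deriv i h x * k x" .
qed

lemma cdiff_minus [simp]: "cdiff_at h x \<Longrightarrow> cdiff_at (\<lambda>w. - h w) x"
  using cdiff_diff[OF cdiff_const, of h x 0] by simp

lemma cdiff_power [simp]: "cdiff_at h x \<Longrightarrow> cdiff_at (\<lambda>w. h w ^ m) x"
  by (induction m) auto

lemma partial_deriv_power: "cdiff_at h x \<Longrightarrow> partial_deriv i (\<lambda>w. h w ^ Suc m) x = of_nat (Suc m) * h x ^ m * partial_deriv i h x"
  by (induction m) (simp_all add: partial_deriv_mult algebra_simps)

lemma cdiff_sum [simp]:
  "(\<And>j. j \<in> A \<Longrightarrow> cdiff_at (h j) x) \<Longrightarrow> cdiff_at (\<lambda>w. \<Sum>j\<in>A. h j w) x"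
  and partial_deriv_sum: "(\<And>j. j \<in> A \<Longrightarrow> cdiff_at (h j) x) \<Longrightarrow> partial_deriv i (\<lambda>w. \<Sum>j\<in>A. h j w) x = (\<Sum>j\<in>A. partial_deriv i (h j) x)"
  by (induction A rule: infinite_finite_induct) (auto simp: partial_deriv_add)

lemma map_has_derivative:
  fixes g :: "complex^'n::finite \<Rightarrow> complex^'m::finite"
  assumes "\<And>j. cdiff_at (\<lambda>w. g w $ j) x"
  shows "(g has_derivative (\<lambda>v. \<chi> j. \<Sum>i\<in>UNIV. partial_deriv i (\<lambda>w. g w $ j) x * v $ i)) (at x)"
  unfolding has_derivative_componentwise_within[of g]
  by (auto simp: Basis_vec_def inner_axis intro!: has_derivative_inner_left cdiff_has_derivative assms)

lemma frechet_derivative_nth: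
  fixes g :: "complex^'n::finite \<Rightarrow> complex^'m::finite"
  assumes "\<And>j. cdiff_at (\<lambda>w. g w $ j) x"
  shows "frechet_derivative g (at x) v $ j = (\<Sum>i\<in>UNIV. partial_deriv i (\<lambda>w. g w $ j) x * v $ i)"
  unfolding frechet_derivative_at[OF map_has_derivative[OF assms], symmetric] by simp

lemma
  fixes g :: "complex^'n::finite \<Rightarrow> complex^'m::finite"
  assumes h: "cdiff_at h (g x)" and g: "\<And>j. cdiff_at (\<lambda>w. g w $ j) x"
  shows cdiff_compose: "cdiff_at (\<lambda>w. h (g w)) x"
    and partial_deriv_compose: "partial_deriv i (\<lambda>w. h (g w)) x = (\<Sum>j\<in>UNIV. partial_deriv j h (g x) * partial_deriv i (\<lambda>w. g w $ j) x)"
proof -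
  note map_has_derivative[of g x, OF g]
  from has_derivative_compose[OF this cdiff_has_derivative[OF h]]
  have "((\<lambda>w. h (g w)) has_derivative
      (\<lambda>v. \<Sum>i\<in>UNIV. (\<Sum>j\<in>UNIV. partial_deriv j h (g x) * partial_deriv i (\<lambda>w. g w $ j) x) * v $ i)) (at x)"
    by (simp add: sum_distrib_left sum_distrib_right mult.assoc sum.swap[of _ "UNIV :: 'm set" "UNIV :: 'n set"])
  from has_derivative_imp_partial_deriv[OF this]
  show "cdiff_at (\<lambda>w. h (g w)) x"
    "partial_deriv i (\<lambda>w. h (g w)) x = (\<Sum>j\<in>UNIV. partial_deriv j h (g x) * partial_deriv i (\<lambda>w. g w $ j) x)" .
qed

lemma cdiff_compose_field:
  assumes h: "cdiff_at h x" and f: "(f has_field_derivative D) (at (h x))"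
  shows "cdiff_at (\<lambda>w. f (h w)) x"
proof -
  have "((\<lambda>w. f (h w)) has_derivative (\<lambda>v. \<Sum>i\<in>UNIV. (D * partial_deriv i h x) * v $ i)) (at x)"
    using has_derivative_compose[OF cdiff_has_derivative[OF h], of f "(*) D"] f
    by (simp add: has_field_derivative_def sum_distrib_left mult.assoc)
  then show ?thesis by (rule has_derivative_imp_partial_deriv)
qed

lemma cdiff_divide [simp]:
  assumes "cdiff_at h x" "cdiff_at k x" "k x \<noteq> 0"
  shows "cdiff_at (\<lambda>w. h w / k w) x"
proof -
  have "cdiff_at (\<lambda>w. inverse (k w)) x"
    by (rule cdiff_compose_field[OF assms(2) DERIV_inverse]) (use assms in auto)
  from cdiff_mult[OF assms(1) this] show ?thesis by (simp add: divide_inverse)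
qed

lemma norm_smult_axis: "norm (s *s (axis i 1 :: complex^'n)) = norm s"
proof -
  have "s *s (axis i 1 :: complex^'n) = axis i s"
    by (simp add: vec_eq_iff axis_def)
  then show ?thesis
    by (simp add: norm_vec_def L2_set_def axis_def if_distrib[of norm] if_distrib[of "\<lambda>x. x ^ 2"] cong: if_cong)
qed

text \<open>
  On a complex line parallel to a coordinate axis the function is holomorphic in one variable, which
  is how Cauchy's integral formulas become available.
\<close>

lemma cdiff_line:
  fixes w :: "complex^'n::finite"
  assumes "cdiff_at h (w + s *s axis i 1)"
  shows "((\<lambda>s. h (w + s *s axis i 1)) has_field_derivative partial_deriv i h (w + s *s axis i 1)) (at s)"
proof -
  have "((\<lambda>s. w + s *s axis i 1) has_derivative (\<lambda>s. s *s axis i 1)) (at s)"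
  proof -
    have "bounded_linear (\<lambda>s::complex. s *s (axis i 1 :: complex^'n))"
      by (intro bounded_linear_intro[where K=1])
         (auto simp: norm_smult_axis vec_eq_iff algebra_simps)
    from has_derivative_add[OF has_derivative_const bounded_linear_imp_has_derivative[OF this]]
    show ?thesis by simp
  qed
  from has_derivative_compose[OF this cdiff_has_derivative[OF assms]]
  show ?thesis
    by (simp add: has_field_derivative_def axis_def if_distrib cong: if_cong)
qed

section \<open>Cauchy integrals depending on a parameter\<close>

text \<open>
  The circle is parametrised over the unit interval. Its velocity at the point \<open>z\<close> is
  \<open>2 \<pi> \<i> z\<close>, so the contour integral of \<open>f\<close> divided by \<open>2 \<pi> \<i>\<close> is the integral of \<open>f(z) z\<close>
  over the unit interval, free of constants.
\<close>

definition circle_point :: "real \<Rightarrow> real \<Rightarrow> complex" where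
  "circle_point r t = of_real r * exp (2 * of_real pi * \<i> * of_real t)"

lemma norm_circle_point: "r > 0 \<Longrightarrow> norm (circle_point r t) = r"
  by (simp add: circle_point_def norm_mult)

lemma continuous_circle_point [continuous_intros]:
  "continuous_on S g \<Longrightarrow> continuous_on S (\<lambda>x. circle_point r (g x))"
  unfolding circle_point_def by (intro continuous_intros)

lemma circle_point_nonzero: "r > 0 \<Longrightarrow> circle_point r t \<noteq> 0"
  by (simp add: circle_point_def)

lemma has_integral_circle_point:
  assumes "(f has_contour_integral I) (circlepath 0 r)"
  shows "((\<lambda>t. f (circle_point r t) * circle_point r t) has_integral (I / (2 * of_real pi * \<i>))) {0..1}"
proof -
  have 1: "circlepath 0 r = circle_point r"
    by (simp add: circlepath circle_point_def fun_eq_iff)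
  have "vector_derivative (circlepath 0 r) (at t within {0..1}) = 2 * of_real pi * \<i> * circle_point r t" if "t \<in> {0..1}" for t
    using vector_derivative_circlepath01[of t 0 r] that by (simp add: circle_point_def mult_ac)
  then have "((\<lambda>t. f (circle_point r t) * (2 * of_real pi * \<i> * circle_point r t)) has_integral I) {0..1}"
    using assms unfolding has_contour_integral_def 1
    by (rule_tac has_integral_eq[rotated, where f="\<lambda>t. f (circle_point r t) * vector_derivative (circle_point r) (at t within {0..1})"]) auto
  from has_integral_mult_right[OF this, of "1 / (2 * of_real pi * \<i>)"]
  show ?thesis by (simp add: field_simps)
qed

lemma cauchy_circle_point:
  assumes "\<And>z. norm z \<le> r \<Longrightarrow> (f has_field_derivative f' z) (at z)" "norm y < r"
  shows "((\<lambda>t. f (circle_point r t) * circle_point r t / (circle_point r t - y)) has_integral f y) {0..1}"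
    and "((\<lambda>t. f (circle_point r t) / circle_point r t) has_integral f' 0) {0..1}"
proof -
  have r: "r > 0" using assms(2) norm_ge_zero le_less_trans by blast
  have c: "continuous_on (cball 0 r) f"
    by (intro continuous_at_imp_continuous_on ballI) (use assms(1) DERIV_isCont in auto)
  have h: "f holomorphic_on ball 0 r"
    unfolding holomorphic_on_def using assms(1)
    by (auto simp: field_differentiable_def intro!: exI DERIV_subset[OF assms(1)])
  from has_integral_circle_point[OF Cauchy_integral_circlepath[OF c h, of y]] assms(2)
  show "((\<lambda>t. f (circle_point r t) * circle_point r t / (circle_point r t - y)) has_integral f y) {0..1}"
    by (simp add: field_simps)
  have z: "0 \<in> ball (0::complex) r" using r by simp
  have "deriv f 0 = f' 0" using assms(1)[of 0] r by (intro DERIV_imp_deriv) auto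
  with has_integral_circle_point[OF Cauchy_has_contour_integral_higher_derivative_circlepath[OF c h z, of 1]]
  show "((\<lambda>t. f (circle_point r t) / circle_point r t) has_integral f' 0) {0..1}"
    using circle_point_nonzero[OF r] by (simp add: power2_eq_square)
qed

text \<open>
  A partial derivative is an integral of values of the function. All regularity of partial
  derivatives below is read off from this formula.
\<close>

lemma partial_deriv_circle_point:
  fixes w :: "complex^'n::finite"
  assumes "\<And>x. x \<in> cball w r \<Longrightarrow> cdiff_at h x" "r > 0"
  shows "((\<lambda>t. h (w + circle_point r t *s axis i 1) / circle_point r t) has_integral partial_deriv i h w) {0..1}"
proof -
  have "((\<lambda>t. h (w + circle_point r t *s axis i 1) / circle_point r t) has_integral partial_deriv i h (w + 0 *s axis i 1)) {0..1}"
  proof (rule cauchy_circle_point(2)[where y=0 and f' = "\<lambda>s. partial_deriv i h (w + s *s axis i 1)"])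
    fix z :: complex assume "norm z \<le> r"
    then have "w + z *s axis i 1 \<in> cball w r" by (simp add: dist_norm norm_smult_axis)
    from cdiff_line[OF assms(1)[OF this]]
    show "((\<lambda>s. h (w + s *s axis i 1)) has_field_derivative partial_deriv i h (w + z *s axis i 1)) (at z)" .
  qed (use assms in auto)
  then show ?thesis by simp
qed

lemma continuous_smult_axis [continuous_intros]:
  "continuous_on S f \<Longrightarrow> continuous_on S (\<lambda>x. f x *s (axis i 1 :: complex^'n::finite))"
  by (intro continuous_on_vec_lambda continuous_intros | simp add: vector_scalar_mult_def)+

text \<open>
  Joint continuity passes from a family to its partial derivatives because these are integrals of
  the family over small circles, as above.
\<close>

lemma partial_deriv_continuous_param:
  fixes F :: "complex^'n::finite \<Rightarrow> real \<Rightarrow> complex"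
  assumes W: "open W"
    and D: "\<And>w t. w \<in> W \<Longrightarrow> t \<in> {0..1} \<Longrightarrow> cdiff_at (\<lambda>w. F w t) w"
    and C: "continuous_on (W \<times> {0..1}) (\<lambda>(w, t). F w t)"
  shows "continuous_on (W \<times> {0..1}) (\<lambda>(w, t). partial_deriv i (\<lambda>w. F w t) w)"
proof -
  have "\<exists>r>0. ball w r \<subseteq> W \<and> continuous_on (ball w r \<times> {0..1}) (\<lambda>(w, t). partial_deriv i (\<lambda>w. F w t) w)" if w: "w \<in> W" for w
  proof -
    from W w obtain e where e: "e > 0" "ball w e \<subseteq> W" by (auto simp: open_contains_ball)
    define r where "r = e / 2"
    have r: "r > 0" using e by (simp add: r_def)
    have sub: "x \<in> W" if "norm (v - w) < r" "dist v x \<le> r" for v x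
    proof -
      have "dist w x \<le> dist w v + dist v x" by (rule dist_triangle)
      also have "\<dots> < e" using that by (simp add: r_def dist_norm norm_minus_commute)
      finally show ?thesis using e by auto
    qed
    have mem: "v + circle_point r s *s axis i 1 \<in> W" if "v \<in> ball w r" for v s
      using that r by (intro sub[of v]) (auto simp: dist_norm norm_minus_commute norm_smult_axis norm_circle_point)
    have eq: "partial_deriv i (\<lambda>w. F w t) v = integral (cbox 0 1) (\<lambda>s. F (v + circle_point r s *s axis i 1) t / circle_point r s)"
      if "v \<in> ball w r" "t \<in> {0..1}" for v t
    proof -
      have "((\<lambda>s. F (v + circle_point r s *s axis i 1) t / circle_point r s) has_integral partial_deriv i (\<lambda>w. F w t) v) {0..1}"
      proof (rule partial_deriv_circle_point[OF D r])
        fix x assume "x \<in> cball v r"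
        then show "x \<in> W" using that(1) by (intro sub[of v]) (simp_all add: dist_norm norm_minus_commute)
      qed (use that in auto)
      then show ?thesis by (simp add: integral_unique)
    qed
    have C': "continuous_on X (\<lambda>x. F (f x) (g x))"
      if "continuous_on X f" "continuous_on X g" "\<forall>x\<in>X. f x \<in> W \<and> g x \<in> {0..1}" for X f and g :: "((complex^'n) \<times> real) \<times> real \<Rightarrow> real"
      using continuous_on_compose2[OF C continuous_on_Pair[OF that(1,2)]] that(3) by (simp add: image_subset_iff)
    have "continuous_on (ball w r \<times> {0..1}) (\<lambda>x. integral (cbox 0 1) (\<lambda>s. F (fst x + circle_point r s *s axis i 1) (snd x) / circle_point r s))"
    proof (rule integral_continuous_on_param)
      show "continuous_on ((ball w r \<times> {0..1}) \<times> cbox 0 1) (\<lambda>(x, s). F (fst x + circle_point r s *s axis i 1) (snd x) / circle_point r s)"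
        unfolding split_beta using r
        by (intro continuous_intros C') (auto simp: circle_point_nonzero intro!: mem)
    qed
    then have "continuous_on (ball w r \<times> {0..1}) (\<lambda>(w, t). partial_deriv i (\<lambda>w. F w t) w)"
      by (rule continuous_on_eq) (auto simp: eq)
    moreover have "ball w r \<subseteq> W" using sub[of w] r by (auto simp: r_def)
    ultimately show ?thesis using r by blast
  qed
  then show ?thesis
    unfolding continuous_on_eq_continuous_within
  proof (intro ballI, clarify)
    fix w t assume H: "\<And>w. w \<in> W \<Longrightarrow> \<exists>r>0. ball w r \<subseteq> W \<and> (\<forall>x\<in>ball w r \<times> {0..1}. continuous (at x within ball w r \<times> {0..1}) (\<lambda>(w, t). partial_deriv i (\<lambda>w. F w t) w))"
      and w: "w \<in> W" and t: "t \<in> {0..1::real}"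
    from H[OF w] obtain r where r: "r > 0" "ball w r \<subseteq> W"
      and c: "continuous (at (w,t) within ball w r \<times> {0..1}) (\<lambda>(w, t). partial_deriv i (\<lambda>w. F w t) w)" using t by auto
    have "at (w,t) within W \<times> {0..1} = at (w,t) within ball w r \<times> {0..1}"
      by (rule at_within_nhd[of _ "ball w r \<times> UNIV"]) (use r in \<open>auto intro: open_Times\<close>)
    then show "continuous (at (w,t) within W \<times> {0..1}) (\<lambda>(w, t). partial_deriv i (\<lambda>w. F w t) w)" using c by simp
  qed
qed

text \<open>
  Leibniz' rule for differentiation under the integral sign; the continuity of the derivatives that
  it requires is \<open>partial_deriv_continuous_param\<close>.
\<close>

lemma
  fixes F :: "complex^'n::finite \<Rightarrow> real \<Rightarrow> complex"
  assumes W: "open W" "w0 \<in> W"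
    and D: "\<And>w t. w \<in> W \<Longrightarrow> t \<in> {0..1} \<Longrightarrow> cdiff_at (\<lambda>w. F w t) w"
    and C: "continuous_on (W \<times> {0..1}) (\<lambda>(w, t). F w t)"
  shows cdiff_integral: "cdiff_at (\<lambda>w. integral {0..1} (F w)) w0"
    and partial_deriv_integral: "((\<lambda>t. partial_deriv i (\<lambda>w. F w t) w0) has_integral partial_deriv i (\<lambda>w. integral {0..1} (F w)) w0) {0..1}"
proof -
  note cp = partial_deriv_continuous_param[OF W(1) D C]
  define L :: "complex^'n \<Rightarrow> real \<Rightarrow> (complex^'n) \<Rightarrow>\<^sub>L complex" where
    "L w t = Blinfun (\<lambda>v. \<Sum>i\<in>UNIV. partial_deriv i (\<lambda>w. F w t) w * v $ i)" for w t
  have bl: "bounded_linear (\<lambda>v :: complex^'n. \<Sum>i\<in>UNIV. a i * v $ i)" for a :: "'n \<Rightarrow> complex"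
    by (intro bounded_linear_sum bounded_linear_compose[OF bounded_linear_mult_right] bounded_linear_vec_nth)
  have L: "blinfun_apply (L w t) v = (\<Sum>i\<in>UNIV. partial_deriv i (\<lambda>w. F w t) w * v $ i)" for w t v
    unfolding L_def by (subst bounded_linear_Blinfun_apply[OF bl]) simp
  from W obtain e where e: "e > 0" "ball w0 e \<subseteq> W" by (auto simp: open_contains_ball)
  have cL: "continuous_on (ball w0 e \<times> {0..1}) (\<lambda>(w,t). L w t)"
  proof (rule continuous_on_blinfun_componentwise)
    fix b :: "complex^'n"
    have "continuous_on (ball w0 e \<times> {0..1}) (\<lambda>x. partial_deriv i (\<lambda>w. F w (snd x)) (fst x))" for i
      using continuous_on_subset[OF cp[of i], of "ball w0 e \<times> {0..1}"] e by (simp add: split_beta Sigma_mono)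
    then have "continuous_on (ball w0 e \<times> {0..1}) (\<lambda>x. \<Sum>i\<in>UNIV. partial_deriv i (\<lambda>w. F w (snd x)) (fst x) * b $ i)"
      by (intro continuous_on_sum continuous_on_mult continuous_on_const)
    then show "continuous_on (ball w0 e \<times> {0..1}) (\<lambda>x. blinfun_apply (case x of (w, t) \<Rightarrow> L w t) b)"
      by (simp add: L split_beta)
  qed
  have iL: "(\<lambda>t. L w0 t) integrable_on {0..1}"
    by (intro integrable_continuous_real continuous_on_compose2[OF cL[unfolded split_beta], of _ "\<lambda>t. (w0, t)", simplified])
       (use e in \<open>auto intro!: continuous_intros\<close>)
  have "((\<lambda>w. integral (cbox 0 1) (F w)) has_derivative integral (cbox 0 1) (L w0)) (at w0 within ball w0 e)"
  proof (rule leibniz_rule)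
    show "((\<lambda>x. F x t) has_derivative blinfun_apply (L x t)) (at x within ball w0 e)"
      if "x \<in> ball w0 e" "t \<in> cbox 0 1" for x t
      using cdiff_has_derivative[OF D, of x t] that subsetD[OF e(2), of x] by (auto simp: L[abs_def] intro: has_derivative_at_withinI)
    show "F x integrable_on cbox 0 1" if "x \<in> ball w0 e" for x
      using that e unfolding box_real
      by (intro integrable_continuous_real continuous_on_compose2[OF C[unfolded split_beta], of _ "\<lambda>t. (x, t)", simplified])
         (auto intro!: continuous_intros)
  qed (use e cL in auto)
  then have der: "((\<lambda>w. integral {0..1} (F w)) has_derivative blinfun_apply (integral {0..1} (L w0))) (at w0)"
    using e by (simp add: at_within_open[of w0 "ball w0 e"])
  have hi: "((\<lambda>t. partial_deriv i (\<lambda>w. F w t) w0) has_integral integral {0..1} (\<lambda>t. partial_deriv i (\<lambda>w. F w t) w0)) {0..1}" for i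
    by (intro integrable_integral integrable_continuous_real
         continuous_on_compose2[OF cp[unfolded split_beta], of _ "\<lambda>t. (w0, t)", simplified])
       (use W in \<open>auto intro!: continuous_intros\<close>)
  have "blinfun_apply (integral {0..1} (L w0)) v = (\<Sum>i\<in>UNIV. integral {0..1} (\<lambda>t. partial_deriv i (\<lambda>w. F w t) w0) * v $ i)" for v
  proof -
    have "((\<lambda>t. \<Sum>i\<in>UNIV. partial_deriv i (\<lambda>w. F w t) w0 * v $ i) has_integral (\<Sum>i\<in>UNIV. integral {0..1} (\<lambda>t. partial_deriv i (\<lambda>w. F w t) w0) * v $ i)) {0..1}"
      by (intro has_integral_sum has_integral_mult_left hi) auto
    moreover have "blinfun_apply (integral {0..1} (L w0)) v = integral {0..1} (\<lambda>t. L w0 t v)"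
      using blinfun_apply_integral[OF iL] by simp
    ultimately show ?thesis by (simp add: L integral_unique)
  qed
  then have "((\<lambda>w. integral {0..1} (F w)) has_derivative (\<lambda>v. \<Sum>i\<in>UNIV. integral {0..1} (\<lambda>t. partial_deriv i (\<lambda>w. F w t) w0) * v $ i)) (at w0)"
    using der by presburger
  from has_derivative_imp_partial_deriv[OF this]
  show "cdiff_at (\<lambda>w. integral {0..1} (F w)) w0"
    "((\<lambda>t. partial_deriv i (\<lambda>w. F w t) w0) has_integral partial_deriv i (\<lambda>w. integral {0..1} (F w)) w0) {0..1}" 
    using hi by auto
qed

section \<open>Holomorphic germs, Hadamard division and even-odd decomposition\<close>

lemma holo_fun_germ_iff: "holo_fun_germ h \<longleftrightarrow> (\<forall>\<^sub>F x in nhds 0. cdiff_at h x)"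
  by (auto simp: holo_fun_germ_def eventually_nhds holo_fun_iff_cdiff)

lemma holo_map_germ_iff: "holo_map_germ h \<longleftrightarrow> (\<forall>i. holo_fun_germ (\<lambda>x. h x $ i))"
proof -
  have "holo_map_germ h \<longleftrightarrow> (\<forall>\<^sub>F x in nhds 0. \<forall>i. cdiff_at (\<lambda>x. h x $ i) x)"
    unfolding holo_map_germ_def eventually_nhds holo_map_def holo_fun_iff_cdiff by blast
  also have "\<dots> \<longleftrightarrow> (\<forall>i. \<forall>\<^sub>F x in nhds 0. cdiff_at (\<lambda>x. h x $ i) x)"
    using eventually_ball_finite_distrib[of UNIV "\<lambda>x i. cdiff_at (\<lambda>x. h x $ i) x" "nhds 0"] by simp
  finally show ?thesis by (simp add: holo_fun_germ_iff)
qed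

text \<open>
  Cauchy's formula exhibits the \<open>i\<close>-th partial derivative as a parameter integral of \<open>h\<close>, so it is
  differentiable again. Its \<open>j\<close>-th derivative is the same integral of the \<open>j\<close>-th derivative of \<open>h\<close>,
  and that is Cauchy's formula for the derivative in the other order.
\<close>

lemma
  fixes h :: "complex^'n::finite \<Rightarrow> complex"
  assumes "\<forall>\<^sub>F y in nhds x. cdiff_at h y"
  shows cdiff_partial_deriv: "cdiff_at (partial_deriv i h) x"
    and partial_deriv_commute: "partial_deriv j (partial_deriv i h) x = partial_deriv i (partial_deriv j h) x"
proof -
  have *: "cdiff_at (partial_deriv i h) x \<and> (\<exists>e>0. \<forall>r. 0 < r \<and> r < e \<longrightarrow>
      ((\<lambda>t. partial_deriv j h (x + circle_point r t *s axis i 1) / circle_point r t) has_integral partial_deriv j (partial_deriv i h) x) {0..1})"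
    if H: "\<forall>\<^sub>F y in nhds x. cdiff_at h y" for x i j
  proof -
    obtain e where e: "e > 0" "\<And>y. dist y x < e \<Longrightarrow> cdiff_at h y"
      using H by (auto simp: eventually_nhds_metric)
    have main: "cdiff_at (partial_deriv i h) x \<and> ((\<lambda>t. partial_deriv j h (x + circle_point r t *s axis i 1) / circle_point r t) has_integral partial_deriv j (partial_deriv i h) x) {0..1}"
      if r: "0 < r" "r < e / 2" for r
    proof -
      define F where "F w t = h (w + circle_point r t *s axis i 1) / circle_point r t" for w t
      have near: "cdiff_at h (w + c *s axis i 1)" if "w \<in> ball x r" "norm c \<le> r" for w c
      proof (rule e(2))
        have "dist (w + c *s axis i 1) x \<le> dist (w + c *s axis i 1) w + dist w x" by (rule dist_triangle)
        also have "\<dots> < e" using that r by (simp add: dist_norm norm_smult_axis norm_minus_commute)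
        finally show "dist (w + c *s axis i 1) x < e" .
      qed
      have near': "cdiff_at h y" if "w \<in> ball x r" "y \<in> cball w r" for w y
      proof (rule e(2))
        have "dist y x \<le> dist y w + dist w x" by (rule dist_triangle)
        also have "\<dots> < e" using that r by (simp add: dist_commute)
        finally show "dist y x < e" .
      qed
      have shift: "cdiff_at (\<lambda>w. h (w + c)) w" "partial_deriv j (\<lambda>w. h (w + c)) w = partial_deriv j h (w + c)"
        if "cdiff_at h (w + c)" for w c
      proof -
        have "((\<lambda>w. h (w + c)) has_derivative (\<lambda>v. \<Sum>i\<in>UNIV. partial_deriv i h (w + c) * v $ i)) (at w)"
          by (rule has_derivative_compose[of "\<lambda>w. w + c" "\<lambda>v. v", OF _ cdiff_has_derivative[OF that]])
             (auto intro!: derivative_eq_intros)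
        from has_derivative_imp_partial_deriv[OF this]
        show "cdiff_at (\<lambda>w. h (w + c)) w" "partial_deriv j (\<lambda>w. h (w + c)) w = partial_deriv j h (w + c)" by auto
      qed
      have D: "cdiff_at (\<lambda>w. F w t) w" if "w \<in> ball x r" "t \<in> {0..1}" for w t
        unfolding F_def using that r by (intro cdiff_divide shift near cdiff_const) (auto simp: norm_circle_point circle_point_nonzero)
      have C: "continuous_on (ball x r \<times> {0..1}) (\<lambda>(w, t). F w t)"
      proof -
        have "continuous_on {y. \<exists>w\<in>ball x r. y \<in> cball w r} h"
          by (intro continuous_at_imp_continuous_on ballI cdiff_continuous) (auto intro: near')
        then have "continuous_on (ball x r \<times> {0..1}) (\<lambda>p. h (fst p + circle_point r (snd p) *s axis i 1))"
          by (rule continuous_on_compose2)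
             (use r in \<open>force intro!: continuous_intros simp: dist_norm norm_smult_axis norm_circle_point\<close>)+
        then show ?thesis unfolding F_def split_beta using r by (intro continuous_intros) (auto simp: circle_point_nonzero)
      qed
      have eq: "integral {0..1} (F w) = partial_deriv i h w" if "w \<in> ball x r" for w
        unfolding F_def by (rule integral_unique, rule partial_deriv_circle_point[OF near'[OF that]]) (use r in auto)
      have ev: "\<forall>\<^sub>F w in nhds x. integral {0..1} (F w) = partial_deriv i h w"
        using eq r by (auto simp: eventually_nhds intro!: exI[of _ "ball x r"])
      have x: "x \<in> ball x r" using r by simp
      note I = cdiff_integral[OF open_ball x D C] partial_deriv_integral[OF open_ball x D C, of j]
      have "partial_deriv j (\<lambda>w. F w t) x = partial_deriv j h (x + circle_point r t *s axis i 1) / circle_point r t" for t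
      proof -
        have c: "cdiff_at h (x + circle_point r t *s axis i 1)" using near[OF x] r by (simp add: norm_circle_point)
        have "partial_deriv j (\<lambda>w. F w t) x = partial_deriv j (\<lambda>w. h (w + circle_point r t *s axis i 1) * (1 / circle_point r t)) x"
          by (simp add: F_def)
        also have "\<dots> = partial_deriv j h (x + circle_point r t *s axis i 1) * (1 / circle_point r t)"
          by (subst partial_deriv_mult) (auto simp: shift c)
        finally show ?thesis by simp
      qed
      with I show ?thesis using cdiff_transform[OF I(1) ev] by simp
    qed
    from main[of "e/4"] main e show ?thesis
      by (intro conjI exI[of _ "e/2"]) auto
  qed
  show "cdiff_at (partial_deriv i h) x" using *[OF assms] by blast
  have "\<forall>\<^sub>F y in nhds x. \<forall>\<^sub>F z in nhds y. cdiff_at h z" using assms by (simp add: eventually_eventually)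
  then have "\<forall>\<^sub>F y in nhds x. cdiff_at (partial_deriv j h) y" by (rule eventually_mono) (use * in blast)
  then obtain d where d: "d > 0" "\<And>y. dist y x < d \<Longrightarrow> cdiff_at (partial_deriv j h) y"
    by (auto simp: eventually_nhds_metric)
  obtain e where e: "e > 0" "\<And>r. 0 < r \<Longrightarrow> r < e \<Longrightarrow>
      ((\<lambda>t. partial_deriv j h (x + circle_point r t *s axis i 1) / circle_point r t) has_integral partial_deriv j (partial_deriv i h) x) {0..1}"
    using *[OF assms, of i j] by blast
  define r where "r = min d e / 2"
  have r: "0 < r" "r < d" "r < e" using d e by (auto simp: r_def)
  have "((\<lambda>t. partial_deriv j h (x + circle_point r t *s axis i 1) / circle_point r t) has_integral partial_deriv i (partial_deriv j h) x) {0..1}"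
    by (rule partial_deriv_circle_point) (use r d in \<open>auto simp: dist_commute\<close>)
  with e(2)[OF r(1,3)] show "partial_deriv j (partial_deriv i h) x = partial_deriv i (partial_deriv j h) x" by (rule has_integral_unique)
qed

lemma holo_fun_germ_partial_deriv: "holo_fun_germ h \<Longrightarrow> holo_fun_germ (partial_deriv i h)"
  unfolding holo_fun_germ_iff
  by (subst (asm) eventually_eventually[symmetric]) (auto elim!: eventually_mono intro: cdiff_partial_deriv)

definition upd_coord :: "'n \<Rightarrow> complex^'n \<Rightarrow> complex \<Rightarrow> complex^'n" where
  "upd_coord i w z = (\<chi> j. if j = i then z else w $ j)"

lemma upd_coord_nth [simp]: "upd_coord i w z $ j = (if j = i then z else w $ j)"
  by (simp add: upd_coord_def)

lemma upd_coord_self [simp]: "upd_coord i w (w $ i) = w"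
  by (simp add: vec_eq_iff)

lemma cdiff_upd_coord:
  fixes w :: "complex^'n::finite"
  assumes "cdiff_at h (upd_coord i w z)"
  shows "cdiff_at (\<lambda>w. h (upd_coord i w z)) w"
proof (rule cdiff_compose[where h = h and g = "\<lambda>w. upd_coord i w z", OF assms])
  show "cdiff_at (\<lambda>w. upd_coord i w z $ j) w" for j by (cases "j = i") simp_all
qed

lemma continuous_on_upd_coord [continuous_intros]:
  assumes "continuous_on S f" "continuous_on S g"
  shows "continuous_on S (\<lambda>x. upd_coord i (f x) (g x) :: complex^'n::finite)"
  unfolding upd_coord_def
proof (rule continuous_on_vec_lambda)
  show "continuous_on S (\<lambda>x. if j = i then g x else f x $ j)" for j
    using assms by (cases "j = i") (auto intro: continuous_intros)
qed

text \<open>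
  A Cauchy integral of \<open>h\<close> in its \<open>i\<close>-th coordinate against a kernel \<open>K\<close> that is holomorphic in the
  parameter. Hadamard's lemma and the even-odd decomposition arise from different kernels.
\<close>

lemma cauchy_kernel:
  fixes h :: "complex^'n::finite \<Rightarrow> complex" and K :: "complex^'n \<Rightarrow> real \<Rightarrow> complex"
  assumes h: "\<And>v. \<forall>j. norm (v $ j) \<le> r \<Longrightarrow> cdiff_at h v" and r: "r > 0"
    and W: "open W" "\<And>w j. w \<in> W \<Longrightarrow> j \<noteq> i \<Longrightarrow> norm (w $ j) \<le> r" "w0 \<in> W"
    and K: "\<And>w t. w \<in> W \<Longrightarrow> cdiff_at (\<lambda>w. K w t) w" 
    and CK: "continuous_on (W \<times> {0..1}) (\<lambda>(w, t). K w t)"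
  shows "cdiff_at (\<lambda>w. integral {0..1} (\<lambda>t. h (upd_coord i w (circle_point r t)) * K w t)) w0"
    and "(\<lambda>t. h (upd_coord i w0 (circle_point r t)) * K w0 t) integrable_on {0..1}"
proof -
  have ch: "continuous_on {v. \<forall>j. norm (v $ j) \<le> r} h"
    by (intro continuous_at_imp_continuous_on ballI cdiff_continuous h) simp
  have "continuous_on (W \<times> {0..1}) (\<lambda>p. h (upd_coord i (fst p) (circle_point r (snd p))))"
    by (rule continuous_on_compose2[OF ch]) (use r W(2) in \<open>auto simp: norm_circle_point intro!: continuous_intros\<close>)
  then have C: "continuous_on (W \<times> {0..1}) (\<lambda>(w, t). h (upd_coord i w (circle_point r t)) * K w t)"
    using CK unfolding split_beta by (rule continuous_on_mult)
  show "cdiff_at (\<lambda>w. integral {0..1} (\<lambda>t. h (upd_coord i w (circle_point r t)) * K w t)) w0"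
  proof (rule cdiff_integral[OF W(1,3) _ C])
    fix w t assume "w \<in> W" "t \<in> {0..1::real}"
    then have "cdiff_at h (upd_coord i w (circle_point r t))"
      using W(2)[of w] r by (intro h) (simp add: norm_circle_point)
    then show "cdiff_at (\<lambda>w. h (upd_coord i w (circle_point r t)) * K w t) w"
      by (rule cdiff_mult[OF cdiff_upd_coord K[OF \<open>w \<in> W\<close>]])
  qed
  show "(\<lambda>t. h (upd_coord i w0 (circle_point r t)) * K w0 t) integrable_on {0..1}"
    by (intro integrable_continuous_real continuous_on_compose2[OF C[unfolded split_beta], of _ "\<lambda>t. (w0, t)", simplified])
       (use W in \<open>auto intro!: continuous_intros\<close>)
qed

lemma cauchy_polydisc:
  fixes h :: "complex^'n::finite \<Rightarrow> complex"
  assumes "holo_fun_germ h"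
  obtains r where "r > 0" "\<And>v. \<forall>j. norm (v $ j) \<le> r \<Longrightarrow> cdiff_at h v"
    "\<forall>\<^sub>F v :: complex^'n in nhds 0. \<forall>j. norm (v $ j) < r"
    "\<And>w z i. \<forall>j. norm (w $ j) < r \<Longrightarrow> norm z < r \<Longrightarrow>
      ((\<lambda>t. h (upd_coord i w (circle_point r t)) * circle_point r t / (circle_point r t - z)) has_integral h (upd_coord i w z)) {0..1}"
proof -
  obtain e where e: "e > 0" "\<And>y. dist y 0 < e \<Longrightarrow> cdiff_at h y"
    using assms by (auto simp: eventually_nhds_metric holo_fun_germ_iff)
  define r where "r = e / (2 * real CARD('n))"
  have r: "r > 0" using e by (simp add: r_def)
  have h: "cdiff_at h v" if "\<forall>j. norm (v $ j) \<le> r" for v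
  proof (rule e(2))
    have "norm v \<le> (\<Sum>j\<in>UNIV. norm (v $ j))" unfolding norm_vec_def by (rule L2_set_le_sum) simp
    also have "\<dots> \<le> (\<Sum>j\<in>(UNIV :: 'n set). r)" using that by (intro sum_mono) auto
    also have "\<dots> < e" using e(1) by (simp add: r_def)
    finally show "dist v 0 < e" by simp
  qed
  have ev: "\<forall>\<^sub>F v :: complex^'n in nhds 0. \<forall>j. norm (v $ j) < r"
    unfolding eventually_nhds_metric
    using r by (intro exI[of _ r]) (auto intro: le_less_trans[OF Finite_Cartesian_Product.norm_nth_le])
  have "((\<lambda>t. h (upd_coord i w (circle_point r t)) * circle_point r t / (circle_point r t - z)) has_integral h (upd_coord i w z)) {0..1}"
    if "\<forall>j. norm (w $ j) < r" "norm z < r" for w z i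
  proof (rule cauchy_circle_point(1)[OF _ that(2)])
    fix s :: complex assume s: "norm s \<le> r"
    have eq: "upd_coord i w 0 + z *s axis i 1 = upd_coord i w z" for z
      by (simp add: vec_eq_iff axis_def)
    have "((\<lambda>s. h (upd_coord i w 0 + s *s axis i 1)) has_field_derivative partial_deriv i h (upd_coord i w 0 + s *s axis i 1)) (at s)"
      by (rule cdiff_line) (unfold eq, rule h, use that s in \<open>auto intro: less_imp_le\<close>)
    then show "((\<lambda>z. h (upd_coord i w z)) has_field_derivative partial_deriv i h (upd_coord i w s)) (at s)"
      by (simp only: eq)
  qed
  with that[OF r h ev] show ?thesis by blast
qed

lemma open_box: "open {w :: complex^'n::finite. \<forall>j. norm (w $ j) < a j}"
proof -
  have "open (\<Inter>j\<in>UNIV. {w :: complex^'n. norm (w $ j) < a j})"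
    by (intro open_INT finite_UNIV ballI open_Collect_less continuous_intros) simp
  then show ?thesis by (simp add: Collect_all_eq)
qed

text \<open>
  For \<open>z\<close> on the circle, \<open>z / (z - y) = z / (z - 0) + y / (z - y)\<close>. Cauchy's formula turns the left
  hand side into \<open>h\<close> and the first summand into the restriction of \<open>h\<close> to \<open>y = 0\<close>, so the quotient is
  the Cauchy integral with kernel \<open>1 / (z - y)\<close>.
\<close>

lemma hadamard:
  fixes h :: "complex^'n::finite \<Rightarrow> complex"
  assumes "holo_fun_germ h"
  obtains k where "holo_fun_germ k" "\<forall>\<^sub>F v in nhds 0. h v = h (upd_coord i v 0) + v $ i * k v"
proof -
  obtain r where r: "r > 0" and h: "\<And>v. \<forall>j. norm (v $ j) \<le> r \<Longrightarrow> cdiff_at h v"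
    and ev: "\<forall>\<^sub>F v :: complex^'n in nhds 0. \<forall>j. norm (v $ j) < r"
    and ci: "\<And>w z i. \<forall>j. norm (w $ j) < r \<Longrightarrow> norm z < r \<Longrightarrow>
      ((\<lambda>t. h (upd_coord i w (circle_point r t)) * circle_point r t / (circle_point r t - z)) has_integral h (upd_coord i w z)) {0..1}"
    by (rule cauchy_polydisc[OF assms]) (rule that)
  define W where "W = {w :: complex^'n. \<forall>j. norm (w $ j) < r}"
  define k where "k w = integral {0..1} (\<lambda>t. h (upd_coord i w (circle_point r t)) * (1 / (circle_point r t - w $ i)))" for w
  have W: "open W" "\<And>w j. w \<in> W \<Longrightarrow> j \<noteq> i \<Longrightarrow> norm (w $ j) \<le> r"
    unfolding W_def using open_box by (auto intro: less_imp_le)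
  have nz: "circle_point r t \<noteq> w $ i" if "w \<in> W" for w t
    using that norm_circle_point[OF r, of t] by (auto simp: W_def dest: spec[of _ i])
  have K: "cdiff_at (\<lambda>w. 1 / (circle_point r t - w $ i)) w" if "w \<in> W" for w t using nz that by simp
  have CK: "continuous_on (W \<times> {0..1}) (\<lambda>(w, t). 1 / (circle_point r t - w $ i))"
    unfolding split_beta by (intro continuous_intros) (auto simp: nz)
  note ker = cauchy_kernel[OF h r W _ K CK]
  have "holo_fun_germ k"
    unfolding holo_fun_germ_iff k_def using ev by (rule eventually_mono) (rule ker(1), auto simp: W_def)
  moreover have "\<forall>\<^sub>F v in nhds 0. h v = h (upd_coord i v 0) + v $ i * k v"
    using ev
  proof (rule eventually_mono)
    fix v :: "complex^'n" assume v: "\<forall>j. norm (v $ j) < r"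
    then have vW: "v \<in> W" by (simp add: W_def)
    have "((\<lambda>t. h (upd_coord i v (circle_point r t)) * circle_point r t / (circle_point r t - 0)) has_integral h (upd_coord i v 0)) {0..1}"
      by (rule ci) (use v r in auto)
    then have "((\<lambda>t. h (upd_coord i v (circle_point r t)) * circle_point r t / (circle_point r t - 0) + v $ i * (h (upd_coord i v (circle_point r t)) * (1 / (circle_point r t - v $ i))))
        has_integral (h (upd_coord i v 0) + v $ i * k v)) {0..1}"
      unfolding k_def
      by (intro has_integral_add has_integral_mult_right integrable_integral ker(2)[OF _ _ _ vW])
    moreover have "h (upd_coord i v (circle_point r t)) * circle_point r t / (circle_point r t - 0) + v $ i * (h (upd_coord i v (circle_point r t)) * (1 / (circle_point r t - v $ i)))
       = h (upd_coord i v (circle_point r t)) * circle_point r t / (circle_point r t - v $ i)" for t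
      using nz[OF vW, of t] circle_point_nonzero[OF r, of t] by (simp add: field_simps)
    ultimately show "h v = h (upd_coord i v 0) + v $ i * k v"
      using ci[of v "v $ i" i] v by (auto dest: has_integral_unique)
  qed
  ultimately show ?thesis by (rule that)
qed

definition square_snd :: "complex^2 \<Rightarrow> complex^2" where "square_snd v = vector [v $ 1, (v $ 2)\<^sup>2]"

lemma square_snd_simps [simp]: "square_snd v $ 1 = v $ 1" "square_snd v $ 2 = (v $ 2)\<^sup>2" by (simp_all add: square_snd_def)

text \<open>
  The Cauchy kernel splits as \<open>z / (z - y) = z^2 / (z^2 - y^2) + y \<cdot> z / (z^2 - y^2)\<close>. Both fractions on
  the right depend on \<open>y\<close> through \<open>y^2\<close> only and remain holomorphic when \<open>y^2\<close> is replaced by an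
  independent variable, which gives the two germs directly.
\<close>

lemma even_odd_decomposition:
  fixes h :: "complex^2 \<Rightarrow> complex"
  assumes "holo_fun_germ h"
  obtains k0 k1 where "holo_fun_germ k0" "holo_fun_germ k1" "\<forall>\<^sub>F v in nhds 0. h v = k0 (square_snd v) + v $ 2 * k1 (square_snd v)"
proof -
  obtain r where r: "r > 0" and h: "\<And>v. \<forall>j. norm (v $ j) \<le> r \<Longrightarrow> cdiff_at h v"
    and ev: "\<forall>\<^sub>F v :: complex^2 in nhds 0. \<forall>j. norm (v $ j) < r"
    and ci: "\<And>w z i. \<forall>j. norm (w $ j) < r \<Longrightarrow> norm z < r \<Longrightarrow>
      ((\<lambda>t. h (upd_coord i w (circle_point r t)) * circle_point r t / (circle_point r t - z)) has_integral h (upd_coord i w z)) {0..1}"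
    by (rule cauchy_polydisc[OF assms]) (rule that)
  \<comment> \<open>The second coordinate stands for \<open>y^2\<close>, hence the radius \<open>r^2\<close>.\<close>
  define W where "W = {w :: complex^2. \<forall>j. norm (w $ j) < (if j = 1 then r else r\<^sup>2)}"
  define K where "K j w t = circle_point r t ^ j / ((circle_point r t)\<^sup>2 - w $ 2)" for j t and w :: "complex^2"
  define k where "k j w = integral {0..1} (\<lambda>t. h (upd_coord 2 w (circle_point r t)) * K j w t)" for j and w :: "complex^2"
  have W: "open W" unfolding W_def by (rule open_box)
  have W2: "norm (w $ j) \<le> r" if "w \<in> W" "j \<noteq> 2" for w j
    using that exhaust_2[of j] by (auto simp: W_def forall_2 intro: less_imp_le)
  have nz: "(circle_point r t)\<^sup>2 \<noteq> w $ 2" if "w \<in> W" for w t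
  proof -
    have "norm ((circle_point r t)\<^sup>2) = r\<^sup>2" using norm_circle_point[OF r] by (simp add: norm_power)
    then show ?thesis using that by (auto simp: W_def forall_2)
  qed
  have K: "cdiff_at (\<lambda>w. K j w t) w" if "w \<in> W" for w t j unfolding K_def using nz that by simp
  have CK: "continuous_on (W \<times> {0..1}) (\<lambda>(w, t). K j w t)" for j
    unfolding split_beta K_def by (intro continuous_intros) (auto simp: nz)
  note ker = cauchy_kernel[where i = 2 and K = "K j" for j, OF h r W W2 _ K CK]
  have evW: "\<forall>\<^sub>F v in nhds 0. v \<in> W"
    by (rule eventually_nhds_in_open[OF W]) (use r in \<open>simp add: W_def\<close>)
  have kh: "holo_fun_germ (k j)" for j
    unfolding holo_fun_germ_iff k_def using evW by (rule eventually_mono) (rule ker(1))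
  moreover have "\<forall>\<^sub>F v in nhds 0. h v = k 2 (square_snd v) + v $ 2 * k 1 (square_snd v)"
    using ev
  proof (rule eventually_mono)
    fix v :: "complex^2" assume v: "\<forall>j. norm (v $ j) < r"
    then have vW: "square_snd v \<in> W" by (simp add: W_def norm_power power_strict_mono forall_2)
    have upd_coord: "upd_coord 2 (square_snd v) z = upd_coord 2 v z" for z by (simp add: vec_eq_iff forall_2)
    have "((\<lambda>t. h (upd_coord 2 (square_snd v) (circle_point r t)) * K 2 (square_snd v) t + v $ 2 * (h (upd_coord 2 (square_snd v) (circle_point r t)) * K 1 (square_snd v) t))
        has_integral (k 2 (square_snd v) + v $ 2 * k 1 (square_snd v))) {0..1}"
      unfolding k_def
      by (intro has_integral_add has_integral_mult_right integrable_integral ker(2)[OF _ _ _ vW])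
    moreover have "h (upd_coord 2 (square_snd v) (circle_point r t)) * K 2 (square_snd v) t + v $ 2 * (h (upd_coord 2 (square_snd v) (circle_point r t)) * K 1 (square_snd v) t)
       = h (upd_coord 2 v (circle_point r t)) * circle_point r t / (circle_point r t - v $ 2)" for t
    proof -
      have f: "(circle_point r t)\<^sup>2 - (v $ 2)\<^sup>2 = (circle_point r t - v $ 2) * (circle_point r t + v $ 2)" by (simp add: power2_eq_square algebra_simps)
      with nz[OF vW, of t] r have "circle_point r t - v $ 2 \<noteq> 0" "circle_point r t + v $ 2 \<noteq> 0" by auto
      then show ?thesis unfolding K_def square_snd_simps f upd_coord
        by (simp add: divide_simps) (simp add: algebra_simps power2_eq_square)
    qed
    ultimately show "h v = k 2 (square_snd v) + v $ 2 * k 1 (square_snd v)"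
      using ci[of v "v $ 2" 2] v by (auto dest: has_integral_unique)
  qed
  ultimately show ?thesis using that by blast
qed

section \<open>Quotients of germ spaces\<close>

lemma field_complex_field: "field complex_field"
proof -
  have "cring complex_field"
    by (intro cringI abelian_groupI comm_monoidI)
       (auto simp: complex_field_def algebra_simps intro: exI[of _ "- _"])
  then show ?thesis
  proof (rule cring.cring_fieldI)
    have "\<exists>y. y * x = 1 \<and> x * y = 1" if "x \<noteq> 0" for x :: complex
      using that by (intro exI[of _ "inverse x"]) simp
    then show "Units complex_field = carrier complex_field - {\<zero>\<^bsub>complex_field\<^esub>}"
      by (auto simp: complex_field_def Units_def)
  qed
qed

text \<open>
  An isomorphism and its inverse carry finite generating sets to each other, so both spaces are finite
  dimensional or neither is.
\<close>

lemma dim_ext_eq_of_isomorphic: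
  assumes "isomorphic_spaces K V W"
  shows "dim_ext K V = dim_ext K W"
proof -
  obtain \<phi> where lin: "linear_map K V W \<phi>" and bij: "bij_betw \<phi> (carrier V) (carrier W)"
    using assms by (auto simp: isomorphic_spaces_def)
  interpret L: linear_map K V W \<phi> by (rule lin)
  define \<psi> where "\<psi> = the_inv_into (carrier V) \<phi>"
  have inj: "inj_on \<phi> (carrier V)" and surj: "\<phi> ` carrier V = carrier W"
    using bij by (auto simp: bij_betw_def)
  have \<psi>: "\<psi> y \<in> carrier V" "\<phi> (\<psi> y) = y" if "y \<in> carrier W" for y
    using that the_inv_into_into[OF inj, of y] f_the_inv_into_f[OF inj, of y] surj by (auto simp: \<psi>_def)
  have \<psi>\<phi>: "\<psi> (\<phi> x) = x" if "x \<in> carrier V" for x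
    using the_inv_into_f_f[OF inj that] by (simp add: \<psi>_def)
  have "linear_map K W V \<psi>"
  proof (intro linear_map.intro mod_hom.intro mod_hom_axioms.intro)
    show "vectorspace K W" "vectorspace K V" "module K W" "module K V" by unfold_locales
    show "\<psi> \<in> module_hom K W V"
      unfolding module_hom_def
    proof (intro CollectI conjI allI impI; (elim conjE)?)
      show "\<psi> \<in> carrier W \<rightarrow> carrier V" using \<psi> by auto
      fix m1 m2 assume m: "m1 \<in> carrier W" "m2 \<in> carrier W"
      have "\<phi> (\<psi> m1 \<oplus>\<^bsub>V\<^esub> \<psi> m2) = m1 \<oplus>\<^bsub>W\<^esub> m2" using m \<psi> by simp
      then show "\<psi> (m1 \<oplus>\<^bsub>W\<^esub> m2) = \<psi> m1 \<oplus>\<^bsub>V\<^esub> \<psi> m2"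
        using \<psi>\<phi>[of "\<psi> m1 \<oplus>\<^bsub>V\<^esub> \<psi> m2"] m \<psi> by simp
    next
      fix r m assume m: "r \<in> carrier K" "m \<in> carrier W"
      have "\<phi> (r \<odot>\<^bsub>V\<^esub> \<psi> m) = r \<odot>\<^bsub>W\<^esub> m" using m \<psi> by simp
      then show "\<psi> (r \<odot>\<^bsub>W\<^esub> m) = r \<odot>\<^bsub>V\<^esub> \<psi> m"
        using \<psi>\<phi>[of "r \<odot>\<^bsub>V\<^esub> \<psi> m"] m \<psi> by simp
    qed
  qed
  then interpret M: linear_map K W V \<psi> .
  have "\<psi> ` carrier W = carrier V" using surj \<psi>\<phi> by force
  then have "vectorspace.fin_dim K V \<longleftrightarrow> vectorspace.fin_dim K W"
    using L.surj_fin_dim surj M.surj_fin_dim by blast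
  then show ?thesis using L.dim_eq[OF _ inj surj] by (auto simp: dim_ext_def)
qed

lemma scale_germ_simps:
  fixes x y :: "('n::finite, 'm::finite) germ"
  shows scale_germ_add: "scale_germ c (x + y) = scale_germ c x + scale_germ c y"
    and scale_germ_add_left: "scale_germ (c + d) x = scale_germ c x + scale_germ d x"
    and scale_germ_mult: "scale_germ (c * d) x = scale_germ c (scale_germ d x)"
    and scale_germ_one: "scale_germ 1 x = x"
  by (transfer; simp add: vec_eq_iff algebra_simps)+

lemma scale_germ_minus_one: "scale_germ (- 1) x = - x" for x :: "('n::finite, 'm::finite) germ"
  by transfer (simp add: vec_eq_iff)

definition germ_space :: "('n, 'm) germ set \<Rightarrow> (complex, ('n::finite, 'm::finite) germ) module" where
  "germ_space C = \<lparr>carrier = C, mult = (\<lambda>_ _. 0), one = 0, zero = 0, add = (+), smult = scale_germ\<rparr>"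

definition germ_subspace :: "('n::finite, 'm::finite) germ set \<Rightarrow> bool" where
  "germ_subspace C \<longleftrightarrow> 0 \<in> C \<and> (\<forall>x\<in>C. \<forall>y\<in>C. x + y \<in> C) \<and> (\<forall>c. \<forall>x\<in>C. scale_germ c x \<in> C)"

lemma germ_subspaceD:
  assumes "germ_subspace C"
  shows "0 \<in> C" "x \<in> C \<Longrightarrow> y \<in> C \<Longrightarrow> x + y \<in> C" "x \<in> C \<Longrightarrow> scale_germ c x \<in> C" "x \<in> C \<Longrightarrow> - x \<in> C"
    "x \<in> C \<Longrightarrow> y \<in> C \<Longrightarrow> x - y \<in> C"
proof -
  show 1: "0 \<in> C" "\<And>x y. x \<in> C \<Longrightarrow> y \<in> C \<Longrightarrow> x + y \<in> C" "\<And>x c. x \<in> C \<Longrightarrow> scale_germ c x \<in> C"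
    using assms by (auto simp: germ_subspace_def)
  show 2: "\<And>x. x \<in> C \<Longrightarrow> - x \<in> C" using 1(3)[of _ "- 1"] by (simp add: scale_germ_minus_one)
  show "x \<in> C \<Longrightarrow> y \<in> C \<Longrightarrow> x - y \<in> C" using 1(2)[of x "- y"] 2[of y] by simp
qed

definition germ_coset :: "('n::finite, 'm::finite) germ set \<Rightarrow> ('n, 'm) germ \<Rightarrow> ('n, 'm) germ set" where
  "germ_coset W x = (\<lambda>w. w + x) ` W"

lemma germ_coset_eq_iff:
  assumes W: "germ_subspace W"
  shows "germ_coset W x = germ_coset W y \<longleftrightarrow> x - y \<in> W"
proof
  assume "germ_coset W x = germ_coset W y"
  moreover have "x \<in> germ_coset W x" using germ_subspaceD(1)[OF W] by (force simp: germ_coset_def)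
  ultimately show "x - y \<in> W" by (auto simp: germ_coset_def)
next
  have *: "germ_coset W x \<subseteq> germ_coset W y" if "x - y \<in> W" for x y
  proof
    fix z assume "z \<in> germ_coset W x"
    then obtain w where "w \<in> W" "z = w + x" by (auto simp: germ_coset_def)
    then have "z = (w + (x - y)) + y" "w + (x - y) \<in> W" using germ_subspaceD(2)[OF W] that by auto
    then show "z \<in> germ_coset W y" unfolding germ_coset_def by (rule image_eqI)
  qed
  assume "x - y \<in> W"
  moreover then have "y - x \<in> W" using germ_subspaceD(4)[OF W, of "x - y"] by simp
  ultimately show "germ_coset W x = germ_coset W y" using * by blast
qed

lemma germ_coset_zero: "germ_coset W 0 = W"
  by (simp add: germ_coset_def)

text \<open>
  The operations of the quotient space are computed on representatives; all vector space axioms for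
  it reduce to those for germs.
\<close>

lemma germ_coset_space_simps:
  assumes W: "germ_subspace W"
  shows "carrier (quotient_space (germ_space C) W) = germ_coset W ` C"
    and "zero (quotient_space (germ_space C) W) = germ_coset W 0"
    and "germ_coset W x \<oplus>\<^bsub>quotient_space (germ_space C) W\<^esub> germ_coset W y = germ_coset W (x + y)"
    and "c \<odot>\<^bsub>quotient_space (germ_space C) W\<^esub> germ_coset W x = germ_coset W (scale_germ c x)"
proof -
  show "carrier (quotient_space (germ_space C) W) = germ_coset W ` C"
    by (auto simp: quotient_space_def A_RCOSETS_def RCOSETS_def r_coset_def germ_space_def germ_coset_def)
  show "zero (quotient_space (germ_space C) W) = germ_coset W 0"
    by (simp add: quotient_space_def germ_coset_zero)
  have "germ_coset W x <+>\<^bsub>germ_space C\<^esub> germ_coset W y = (\<Union>u\<in>W. \<Union>v\<in>W. {(u + v) + (x + y)})"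
    by (auto simp: set_add_def set_mult_def germ_space_def germ_coset_def algebra_simps)
  also have "\<dots> = germ_coset W (x + y)"
  proof -
    have "\<exists>u\<in>W. \<exists>v\<in>W. w = u + v" if "w \<in> W" for w
      using that germ_subspaceD(1)[OF W] by (metis add.left_neutral)
    then show ?thesis using germ_subspaceD(2)[OF W] by (fastforce simp: germ_coset_def)
  qed
  finally show "germ_coset W x \<oplus>\<^bsub>quotient_space (germ_space C) W\<^esub> germ_coset W y = germ_coset W (x + y)"
    by (simp add: quotient_space_def)
  have r: "W +>\<^bsub>germ_space C\<^esub> z = germ_coset W z" for z
    by (auto simp: a_r_coset_def r_coset_def germ_space_def germ_coset_def)
  have "germ_coset W (scale_germ c z) = germ_coset W (scale_germ c x)" if "z \<in> germ_coset W x" for z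
    using that germ_subspaceD(3)[OF W] 
    by (subst germ_coset_eq_iff[OF W]) (auto simp: germ_coset_def scale_germ_add)
  moreover have "x \<in> germ_coset W x" using germ_subspaceD(1)[OF W] by (force simp: germ_coset_def)
  ultimately have "(\<Union>z\<in>germ_coset W x. germ_coset W (scale_germ c z)) = germ_coset W (scale_germ c x)" by blast
  then show "c \<odot>\<^bsub>quotient_space (germ_space C) W\<^esub> germ_coset W x = germ_coset W (scale_germ c x)"
    by (simp add: quotient_space_def r) (simp add: germ_space_def)
qed

lemma vectorspace_quotient:
  assumes C: "germ_subspace C" and W: "germ_subspace W"
  shows "vectorspace complex_field (quotient_space (germ_space C) W)" (is "vectorspace _ ?Q")
proof -
  note S = germ_coset_space_simps[OF W, of C]
  have c: "carrier complex_field = UNIV" "\<And>a b. a \<oplus>\<^bsub>complex_field\<^esub> b = a + b"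
    "\<And>a b. a \<otimes>\<^bsub>complex_field\<^esub> b = a * b" "\<one>\<^bsub>complex_field\<^esub> = 1"
    by (simp_all add: complex_field_def)
  interpret F: field complex_field by (rule field_complex_field)
  have "abelian_group ?Q"
  proof (rule abelian_groupI)
    fix A assume "A \<in> carrier ?Q"
    then obtain x where x: "x \<in> C" "A = germ_coset W x" by (auto simp: S)
    then have "germ_coset W (- x) \<in> carrier ?Q" "germ_coset W (- x) \<oplus>\<^bsub>?Q\<^esub> A = \<zero>\<^bsub>?Q\<^esub>"
      using germ_subspaceD[OF C] by (auto simp: S)
    then show "\<exists>B\<in>carrier ?Q. B \<oplus>\<^bsub>?Q\<^esub> A = \<zero>\<^bsub>?Q\<^esub>" by blast
  qed (use germ_subspaceD[OF C] in \<open>auto simp: S algebra_simps\<close>)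
  moreover have "cring complex_field" by (rule F.is_cring)
  ultimately have "module complex_field ?Q"
    by (intro moduleI) (use germ_subspaceD[OF C] in \<open>auto simp: S c scale_germ_simps\<close>)
  then show ?thesis by (intro vectorspace.intro field_complex_field)
qed

text \<open>
  Taking images under \<open>T\<close> maps the coset of \<open>x\<close> onto the coset of \<open>T x\<close>, and it is injective on cosets
  since \<open>T\<close> identifies \<open>W\<close> with its image.
\<close>

lemma isomorphic_quotients:
  fixes T :: "('n::finite, 'm::finite) germ \<Rightarrow> ('k::finite, 'l::finite) germ"
  assumes sub: "germ_subspace C" "germ_subspace W" "W \<subseteq> C"
    and add: "\<And>x y. T (x + y) = T x + T y" and scale: "\<And>c x. T (scale_germ c x) = scale_germ c (T x)"
    and inj: "inj_on T C"
  shows "germ_subspace (T ` C)" 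
    and "isomorphic_spaces complex_field (quotient_space (germ_space C) W)
      (quotient_space (germ_space (T ` C)) (T ` W))" (is "isomorphic_spaces _ ?Q ?R")
proof -
  have im: "germ_subspace (T ` D)" if D: "germ_subspace D" for D
  proof -
    have "T 0 = 0" using add[of 0 0] by simp
    then have "0 \<in> T ` D" using germ_subspaceD(1)[OF D] by (metis image_eqI)
    then show ?thesis
      unfolding germ_subspace_def using germ_subspaceD(2,3)[OF D]
      by (auto simp: add[symmetric] scale[symmetric])
  qed
  show C': "germ_subspace (T ` C)" by (rule im[OF sub(1)])
  have W': "germ_subspace (T ` W)" by (rule im[OF sub(2)])
  note S = germ_coset_space_simps[OF sub(2), of C] germ_coset_space_simps[OF W', of "T ` C"]
  have co: "T ` germ_coset W x = germ_coset (T ` W) (T x)" for x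
    by (auto simp: germ_coset_def add image_image)
  have lin: "linear_map complex_field ?Q ?R ((`) T)"
  proof (intro linear_map.intro mod_hom.intro mod_hom_axioms.intro)
    show v: "vectorspace complex_field ?Q" "vectorspace complex_field ?R"
      by (intro vectorspace_quotient sub C' W')+
    show "module complex_field ?Q" "module complex_field ?R"
      using v by (simp_all add: vectorspace_def)
    show "(`) T \<in> module_hom complex_field ?Q ?R"
    proof -
      have "T ` germ_coset W x \<in> carrier ?R" if "x \<in> C" for x using that by (simp add: S co)
      moreover have "T ` (A \<oplus>\<^bsub>?Q\<^esub> B) = T ` A \<oplus>\<^bsub>?R\<^esub> T ` B" if "A \<in> carrier ?Q" "B \<in> carrier ?Q" for A B
        using that unfolding S by (elim imageE) (simp only: S co add)
      moreover have "T ` (c \<odot>\<^bsub>?Q\<^esub> A) = c \<odot>\<^bsub>?R\<^esub> (T ` A)" if "A \<in> carrier ?Q" for c A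
        using that unfolding S by (elim imageE) (simp only: S co scale)
      ultimately show ?thesis unfolding module_hom_def by (auto simp: S(1))
    qed
  qed
  have diff: "T (x - y) = T x - T y" for x y using add[of "x - y" y] by (simp add: algebra_simps)
  have "bij_betw ((`) T) (carrier ?Q) (carrier ?R)"
  proof (rule bij_betw_imageI)
    show "inj_on ((`) T) (carrier ?Q)"
    proof (rule inj_onI)
      fix A B assume "A \<in> carrier ?Q" "B \<in> carrier ?Q" and eq: "T ` A = T ` B"
      then obtain x y where xy: "x \<in> C" "A = germ_coset W x" "y \<in> C" "B = germ_coset W y" by (auto simp: S)
      with eq have "T (x - y) \<in> T ` W" by (simp add: co germ_coset_eq_iff[OF W'] diff)
      then obtain w where w: "w \<in> W" "T (x - y) = T w" by auto
      have "x - y = w"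
        by (rule inj_onD[OF inj w(2)]) (use xy w sub germ_subspaceD(5)[OF sub(1)] in auto)
      then show "A = B" using w xy by (simp add: germ_coset_eq_iff[OF sub(2)])
    qed
    show "(`) T ` carrier ?Q = carrier ?R" by (auto simp: S co image_image)
  qed
  with lin show "isomorphic_spaces complex_field ?Q ?R" by (auto simp: isomorphic_spaces_def)
qed

section \<open>The extended tangent space of a fold map\<close>

lemma eventually_compose_0:
  assumes "\<forall>\<^sub>F w in nhds 0. P w" "isCont g 0" "g 0 = 0"
  shows "\<forall>\<^sub>F v in nhds 0. P (g v)"
  using assms filterlim_iff[of g "nhds 0" "nhds 0"] isCont_def tendsto_at_iff_tendsto_nhds[of g 0] by metis

lemma isCont_map:
  fixes g :: "complex^'n::finite \<Rightarrow> complex^'m::finite"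
  assumes "\<And>j. holo_fun_germ (\<lambda>w. g w $ j)"
  shows "isCont g 0"
proof (rule has_derivative_continuous[OF map_has_derivative])
  show "cdiff_at (\<lambda>w. g w $ j) 0" for j
    using eventually_nhds_x_imp_x[OF assms[unfolded holo_fun_germ_iff, of j]] .
qed

named_theorems holo_germ

lemma holo_germ_const [holo_germ]: "holo_fun_germ (\<lambda>_. c)"
  and holo_germ_coord [holo_germ]: "holo_fun_germ (\<lambda>v. v $ i)"
  by (simp_all add: holo_fun_germ_iff)

lemma
  assumes "holo_fun_germ h" "holo_fun_germ k"
  shows holo_germ_add [holo_germ]: "holo_fun_germ (\<lambda>v. h v + k v)"
    and holo_germ_diff [holo_germ]: "holo_fun_germ (\<lambda>v. h v - k v)"
    and holo_germ_mult [holo_germ]: "holo_fun_germ (\<lambda>v. h v * k v)"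
  using assms unfolding holo_fun_germ_iff by (auto elim: eventually_elim2)

lemma holo_germ_minus [holo_germ]: "holo_fun_germ h \<Longrightarrow> holo_fun_germ (\<lambda>v. - h v)"
  unfolding holo_fun_germ_iff by (auto elim: eventually_mono)

lemma holo_germ_power [holo_germ]: "holo_fun_germ h \<Longrightarrow> holo_fun_germ (\<lambda>v. h v ^ m)"
  unfolding holo_fun_germ_iff by (auto elim: eventually_mono)

lemma holo_germ_divide_const [holo_germ]: "holo_fun_germ h \<Longrightarrow> holo_fun_germ (\<lambda>v. h v / c)"
  using holo_germ_mult[OF _ holo_germ_const[of "inverse c"]] by (simp add: divide_inverse)

lemma holo_germ_compose:
  fixes g :: "complex^'n::finite \<Rightarrow> complex^'m::finite"
  assumes "holo_fun_germ h" "\<And>j. holo_fun_germ (\<lambda>w. g w $ j)" "g 0 = 0"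
  shows "holo_fun_germ (\<lambda>v. h (g v))"
proof -
  have "\<forall>\<^sub>F v in nhds 0. cdiff_at h (g v)"
    using eventually_compose_0[OF assms(1)[unfolded holo_fun_germ_iff] isCont_map[OF assms(2)] assms(3)] .
  moreover have "\<forall>\<^sub>F v in nhds 0. \<forall>j\<in>UNIV. cdiff_at (\<lambda>w. g w $ j) v"
    using assms(2) by (subst eventually_ball_finite_distrib) (auto simp: holo_fun_germ_iff)
  ultimately show ?thesis
    unfolding holo_fun_germ_iff
  proof eventually_elim
    case (elim v)
    then show ?case using cdiff_compose[of h g v] by blast
  qed
qed

lemma holo_germ_cong: "\<forall>\<^sub>F v in nhds 0. h v = k v \<Longrightarrow> holo_fun_germ h \<longleftrightarrow> holo_fun_germ k"
proof -
  have *: "holo_fun_germ k" if "\<forall>\<^sub>F v in nhds 0. h v = k v" "holo_fun_germ h" for h k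
  proof -
    have "\<forall>\<^sub>F v in nhds 0. \<forall>\<^sub>F y in nhds v. h y = k y" using that(1) by (simp add: eventually_eventually)
    then show ?thesis using that(2) unfolding holo_fun_germ_iff
      by eventually_elim (rule cdiff_transform)
  qed
  assume "\<forall>\<^sub>F v in nhds 0. h v = k v"
  moreover from this have "\<forall>\<^sub>F v in nhds 0. k v = h v" by (simp add: eq_commute)
  ultimately show ?thesis using * by blast
qed

lemma holo_map_germ_vector3:
  "holo_map_germ (\<lambda>v. vector [a v, b v, c v] :: complex^3) \<longleftrightarrow> holo_fun_germ a \<and> holo_fun_germ b \<and> holo_fun_germ c"
  by (simp add: holo_map_germ_iff forall_3)

lemma holo_map_germ_vector2:
  "holo_map_germ (\<lambda>v. vector [a v, b v] :: complex^2) \<longleftrightarrow> holo_fun_germ a \<and> holo_fun_germ b"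
  by (simp add: holo_map_germ_iff forall_2)

lemma vector3_eq_iff: "(v :: complex^3) = w \<longleftrightarrow> v $ 1 = w $ 1 \<and> v $ 2 = w $ 2 \<and> v $ 3 = w $ 3"
  by (simp add: vec_eq_iff forall_3)

lemma square_snd_zero: "square_snd 0 = 0"
  by (simp add: vec_eq_iff forall_2)

lemma holo_germ_square_snd [holo_germ]:
  assumes "holo_fun_germ h"
  shows "holo_fun_germ (\<lambda>v. h (square_snd v))"
proof (rule holo_germ_compose[where g = square_snd, OF assms _ square_snd_zero])
  show "holo_fun_germ (\<lambda>w. square_snd w $ j)" for j
    using exhaust_2[of j] by (auto intro!: holo_germ)
qed

lemma eventually_square_snd:
  assumes "\<forall>\<^sub>F w in nhds 0. P w"
  shows "\<forall>\<^sub>F v in nhds 0. P (square_snd v)"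
proof (rule eventually_compose_0[where g = square_snd, OF assms _ square_snd_zero], rule isCont_map)
  show "holo_fun_germ (\<lambda>w. square_snd w $ j)" for j
    using exhaust_2[of j] by (auto intro!: holo_germ)
qed

text \<open>
  Both maps of the theorem belong to this family, and their tangent spaces are computed
  simultaneously.
\<close>

definition fold_map :: "nat \<Rightarrow> (complex^2 \<Rightarrow> complex) \<Rightarrow> complex^2 \<Rightarrow> complex^3" where
  "fold_map k p v = vector [v $ 1, (v $ 2)\<^sup>2, (v $ 2) ^ (2 * k + 1) * p (square_snd v)]"

lemma fold_surface_eq: "fold_surface p = fold_map 0 p"
  by (simp add: fold_surface_def fold_map_def square_snd_def fun_eq_iff Let_def)

lemma fold_frontalisation_eq: "fold_frontalisation p = fold_map 1 p"
  by (simp add: fold_frontalisation_def fold_map_def square_snd_def fun_eq_iff Let_def numeral_3_eq_3)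

lemma fold_map_nth [simp]:
  "fold_map k p v $ 1 = v $ 1" "fold_map k p v $ 2 = (v $ 2)\<^sup>2" "fold_map k p v $ 3 = (v $ 2) ^ (2 * k + 1) * p (square_snd v)"
  by (simp_all add: fold_map_def)

lemma fold_map_zero: "fold_map k p 0 = 0"
  by (simp add: vec_eq_iff forall_3)

lemma holo_fold_map:
  assumes "holo_fun_germ p"
  shows "holo_fun_germ (\<lambda>v. fold_map k p v $ j)"
  using exhaust_3[of j] assms by (auto intro!: holo_germ)

lemma partial_deriv_square_snd:
  assumes "cdiff_at p (square_snd v)"
  shows "cdiff_at (\<lambda>v. p (square_snd v)) v" "partial_deriv 1 (\<lambda>v. p (square_snd v)) v = partial_deriv 1 p (square_snd v)"
    "partial_deriv 2 (\<lambda>v. p (square_snd v)) v = 2 * v $ 2 * partial_deriv 2 p (square_snd v)"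
proof -
  have c: "cdiff_at (\<lambda>w. square_snd w $ j) v" for j using exhaust_2[of j] by auto
  have 2: "partial_deriv i (\<lambda>w. (w $ 2)\<^sup>2) v = 2 * v $ 2 * (if i = 2 then 1 else 0)" for i
    using partial_deriv_power[of "\<lambda>w. w $ 2" v i 1] by (simp add: partial_deriv_coord numeral_2_eq_2)
  show "cdiff_at (\<lambda>v. p (square_snd v)) v" by (rule cdiff_compose[OF assms c])
  show "partial_deriv 1 (\<lambda>v. p (square_snd v)) v = partial_deriv 1 p (square_snd v)" "partial_deriv 2 (\<lambda>v. p (square_snd v)) v = 2 * v $ 2 * partial_deriv 2 p (square_snd v)"
    by (subst partial_deriv_compose[of p square_snd v, OF assms c], simp add: sum_2 partial_deriv_coord 2)+
qed

lemma frechet_derivative_fold_map: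
  assumes p: "cdiff_at p (square_snd v)"
  shows "frechet_derivative (fold_map k p) (at v) u = vector [u $ 1, 2 * v $ 2 * u $ 2,
    (v $ 2) ^ (2 * k + 1) * partial_deriv 1 p (square_snd v) * u $ 1 +
    ((2 * of_nat k + 1) * (v $ 2) ^ (2 * k) * p (square_snd v) + 2 * (v $ 2) ^ (2 * k + 2) * partial_deriv 2 p (square_snd v)) * u $ 2]"
proof -
  have c: "cdiff_at (\<lambda>w. fold_map k p w $ j) v" for j
    using exhaust_3[of j] partial_deriv_square_snd(1)[OF p] by auto
  have pw: "partial_deriv i (\<lambda>w. (w $ 2) ^ Suc m) v = of_nat (Suc m) * (v $ 2) ^ m * (if i = 2 then 1 else 0)" for i m
    using partial_deriv_power[of "\<lambda>w. w $ 2" v i m] by (simp add: partial_deriv_coord)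
  have pw2: "partial_deriv i (\<lambda>w. (w $ 2)\<^sup>2) v = 2 * v $ 2 * (if i = 2 then 1 else 0)" for i
    using pw[of i 1] by (simp add: numeral_2_eq_2)
  have "partial_deriv i (\<lambda>w. fold_map k p w $ 3) v = (v $ 2) ^ (2 * k + 1) * partial_deriv i (\<lambda>v. p (square_snd v)) v +
      partial_deriv i (\<lambda>w. (w $ 2) ^ Suc (2 * k)) v * p (square_snd v)" for i
    using partial_deriv_mult[of "\<lambda>w. (w $ 2) ^ (2 * k + 1)" v "\<lambda>v. p (square_snd v)" i] partial_deriv_square_snd(1)[OF p] by simp
  then have pd3: "partial_deriv 1 (\<lambda>w. (w $ 2) ^ (2 * k + 1) * p (square_snd w)) v = (v $ 2) ^ (2 * k + 1) * partial_deriv 1 p (square_snd v)"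
    "partial_deriv 2 (\<lambda>w. (w $ 2) ^ (2 * k + 1) * p (square_snd w)) v =
      (2 * of_nat k + 1) * (v $ 2) ^ (2 * k) * p (square_snd v) + 2 * (v $ 2) ^ (2 * k + 2) * partial_deriv 2 p (square_snd v)"
    unfolding pw by (simp_all add: partial_deriv_square_snd(2,3)[OF p] algebra_simps)
  show ?thesis
    unfolding vector3_eq_iff frechet_derivative_nth[of "fold_map k p", OF c]
    by (simp only: vector_3 fold_map_nth sum_2 partial_deriv_coord pw2 pd3) simp
qed

lemma germ_of_eq_iff: "germ_of h = germ_of k \<longleftrightarrow> (\<forall>\<^sub>F x in nhds 0. h x = k x)"
  by (rule germ.abs_eq_iff)

text \<open>
  Hadamard's lemma in the third target coordinate writes \<open>e(X,Y,Z) = e(X,Y,0) + Z q(X,Y,Z)\<close>. Under the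
  fold map, \<open>Z = y^(2k+1) p\<close> is odd in \<open>y\<close>, so the odd part of the pull-back of \<open>q\<close> only contributes to
  the even part of the result.
\<close>

lemma pullback_fold_map:
  assumes p: "holo_fun_germ p" and e: "holo_fun_germ (e :: complex^3 \<Rightarrow> complex)"
  obtains a b where "holo_fun_germ a" "holo_fun_germ b"
    "\<forall>\<^sub>F v in nhds 0. e (fold_map k p v) = a (square_snd v) + (v $ 2) ^ (2 * k + 1) * p (square_snd v) * b (square_snd v)"
proof -
  obtain q where q: "holo_fun_germ q" and e_eq: "\<forall>\<^sub>F w in nhds 0. e w = e (upd_coord 3 w 0) + w $ 3 * q w"
    by (rule hadamard[OF e, of 3])
  have cont: "isCont (fold_map k p) 0" by (rule isCont_map) (rule holo_fold_map[OF p])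
  have "holo_fun_germ (\<lambda>v. q (fold_map k p v))"
    by (rule holo_germ_compose[where g = "fold_map k p", OF q holo_fold_map[OF p] fold_map_zero])
  then obtain q0 q1 where q01: "holo_fun_germ q0" "holo_fun_germ q1"
    "\<forall>\<^sub>F v in nhds 0. q (fold_map k p v) = q0 (square_snd v) + v $ 2 * q1 (square_snd v)"
    by (rule even_odd_decomposition)
  define a where "a w = e (vector [w $ 1, w $ 2, 0]) + (w $ 2) ^ (k + 1) * p w * q1 w" for w
  have "holo_fun_germ (\<lambda>w :: complex^2. e (vector [w $ 1, w $ 2, 0]))"
  proof (rule holo_germ_compose[where g = "\<lambda>w. vector [w $ 1, w $ 2, 0]", OF e])
    show "holo_fun_germ (\<lambda>w :: complex^2. (vector [w $ 1, w $ 2, 0] :: complex^3) $ j)" for j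
      using exhaust_3[of j] by (auto intro!: holo_germ)
  qed (simp add: vec_eq_iff forall_3)
  then have "holo_fun_germ a" unfolding a_def by (intro holo_germ p q01)
  moreover have "\<forall>\<^sub>F v in nhds 0. e (fold_map k p v) = a (square_snd v) + (v $ 2) ^ (2 * k + 1) * p (square_snd v) * q0 (square_snd v)"
    using eventually_compose_0[where g = "fold_map k p", OF e_eq cont fold_map_zero] q01(3)
  proof eventually_elim
    case (elim v)
    have u: "upd_coord 3 (fold_map k p v) 0 = vector [v $ 1, (v $ 2)\<^sup>2, 0]"
      by (simp add: vector3_eq_iff)
    show ?case unfolding elim(1) unfolding elim(2) u
      by (simp add: a_def algebra_simps power_add power_mult power2_eq_square)
  qed
  ultimately show ?thesis using that q01(1) by blast
qed

text \<open>
  Fields whose third component has an odd part \<open>y^(2k+1) c1(x,y^2)\<close> subject to the condition \<open>N\<close> on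
  \<open>c1\<close>. The modules of all vector fields, of frontal deformations, and the two tangent spaces are all of
  this form.
\<close>

definition odd_part_space :: "nat \<Rightarrow> ((complex^2 \<Rightarrow> complex) \<Rightarrow> bool) \<Rightarrow> (2, 3) germ set" where
  "odd_part_space k N = {germ_of z | z. holo_map_germ z \<and> (\<exists>c0 c1. holo_fun_germ c0 \<and> holo_fun_germ c1 \<and> N c1 \<and>
     (\<forall>\<^sub>F v in nhds 0. z v $ 3 = c0 (square_snd v) + (v $ 2) ^ (2 * k + 1) * c1 (square_snd v)))}"

text \<open>
  Membership of a germ in the ideal generated by \<open>p_X\<close>, \<open>p\<close> and \<open>Y p_Y\<close>.
\<close>

definition fold_ideal :: "(complex^2 \<Rightarrow> complex) \<Rightarrow> (complex^2 \<Rightarrow> complex) \<Rightarrow> bool" where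
  "fold_ideal p c \<longleftrightarrow> (\<exists>A B C. holo_fun_germ A \<and> holo_fun_germ B \<and> holo_fun_germ C \<and>
     (\<forall>\<^sub>F w in nhds 0. c w = partial_deriv 1 p w * A w + p w * B w + w $ 2 * partial_deriv 2 p w * C w))"

text \<open>
  With \<open>\<xi>\<^sub>1 = u0 + y u1\<close>, \<open>\<xi>\<^sub>2 = t0 + y t1\<close> and \<open>\<eta>\<^sub>3\<close> pulling back to \<open>a + y^(2k+1) p b\<close>, the terms of the
  third component that are odd in \<open>y\<close> are
  \<open>y^(2k+1) (p_X u0 + ((2k+1) p + 2 Y p_Y) t1 + p b)\<close>.
\<close>

lemma TAe_fold_map_subset:
  assumes p: "holo_fun_germ p"
  shows "TAe (fold_map k p) \<subseteq> odd_part_space k (fold_ideal p)"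
proof
  fix g assume "g \<in> TAe (fold_map k p)"
  then obtain \<xi> \<eta> where \<xi>: "\<And>i. holo_fun_germ (\<lambda>v. \<xi> v $ i)" and \<eta>: "\<And>i. holo_fun_germ (\<lambda>w. \<eta> w $ i)"
    and g: "g = germ_of (\<lambda>x. frechet_derivative (fold_map k p) (at x) (\<xi> x) + \<eta> (fold_map k p x))"
    by (auto simp: TAe_def holo_map_germ_iff)
  define z where "z v = vector [\<xi> v $ 1, 2 * v $ 2 * \<xi> v $ 2,
    (v $ 2) ^ (2 * k + 1) * partial_deriv 1 p (square_snd v) * \<xi> v $ 1 +
    ((2 * of_nat k + 1) * (v $ 2) ^ (2 * k) * p (square_snd v) + 2 * (v $ 2) ^ (2 * k + 2) * partial_deriv 2 p (square_snd v)) * \<xi> v $ 2]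
    + \<eta> (fold_map k p v)" for v
  have ev: "\<forall>\<^sub>F v in nhds 0. frechet_derivative (fold_map k p) (at v) (\<xi> v) + \<eta> (fold_map k p v) = z v"
    using eventually_square_snd[OF p[unfolded holo_fun_germ_iff]]
    by (rule eventually_mono) (simp add: frechet_derivative_fold_map z_def)
  have \<eta>f: "holo_fun_germ (\<lambda>v. \<eta> (fold_map k p v) $ i)" for i
    by (rule holo_germ_compose[where g = "fold_map k p", OF \<eta> holo_fold_map[OF p] fold_map_zero])
  have "holo_fun_germ (\<lambda>v. z v $ i)" for i
    using exhaust_3[of i] unfolding z_def
    by (auto intro!: holo_germ \<xi> \<eta>f p holo_fun_germ_partial_deriv)
  then have hz: "holo_map_germ z" by (simp add: holo_map_germ_iff)
  obtain u0 u1 where u: "holo_fun_germ u0" "holo_fun_germ u1" "\<forall>\<^sub>F v in nhds 0. \<xi> v $ 1 = u0 (square_snd v) + v $ 2 * u1 (square_snd v)"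
    by (rule even_odd_decomposition[OF \<xi>[of 1]])
  obtain t0 t1 where t: "holo_fun_germ t0" "holo_fun_germ t1" "\<forall>\<^sub>F v in nhds 0. \<xi> v $ 2 = t0 (square_snd v) + v $ 2 * t1 (square_snd v)"
    by (rule even_odd_decomposition[OF \<xi>[of 2]])
  obtain a b where ab: "holo_fun_germ a" "holo_fun_germ b"
    "\<forall>\<^sub>F v in nhds 0. \<eta> (fold_map k p v) $ 3 = a (square_snd v) + (v $ 2) ^ (2 * k + 1) * p (square_snd v) * b (square_snd v)"
    by (rule pullback_fold_map[OF p \<eta>[of 3]])
  define c0 where "c0 w = a w + (w $ 2) ^ (k + 1) * partial_deriv 1 p w * u1 w
    + ((2 * of_nat k + 1) * (w $ 2) ^ k * p w + 2 * (w $ 2) ^ (k + 1) * partial_deriv 2 p w) * t0 w" for w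
  define c1 where "c1 w = partial_deriv 1 p w * u0 w + p w * (b w + (2 * of_nat k + 1) * t1 w) + w $ 2 * partial_deriv 2 p w * (2 * t1 w)" for w
  have "fold_ideal p c1"
    unfolding fold_ideal_def
    by (intro exI[of _ u0] exI[of _ "\<lambda>w. b w + (2 * of_nat k + 1) * t1 w"] exI[of _ "\<lambda>w. 2 * t1 w"] conjI)
       (auto simp: c1_def intro!: holo_germ u t ab)
  moreover have "holo_fun_germ c0" "holo_fun_germ c1"
    unfolding c0_def c1_def by (intro holo_germ holo_fun_germ_partial_deriv p u t ab)+
  moreover have "\<forall>\<^sub>F v in nhds 0. z v $ 3 = c0 (square_snd v) + (v $ 2) ^ (2 * k + 1) * c1 (square_snd v)"
    using u(3) t(3) ab(3)
  proof eventually_elim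
    case (elim v)
    show ?case unfolding z_def c0_def c1_def vector_add_component vector_3 elim square_snd_simps
      by (simp add: algebra_simps power_add power_mult power2_eq_square)
  qed
  moreover have "g = germ_of z" unfolding g germ_of_eq_iff by (rule ev)
  ultimately show "g \<in> odd_part_space k (fold_ideal p)" unfolding odd_part_space_def using hz by blast
qed

text \<open>
  Conversely, let \<open>p_X A + p B + Y p_Y C\<close> be the odd coefficient of the third component. The even part
  of \<open>\<xi>\<^sub>1\<close> is taken to be \<open>A\<close> and the odd part of \<open>\<xi>\<^sub>2\<close> to be \<open>y C / 2\<close>. The odd parts of the first two
  components of \<open>z\<close> determine the remaining halves of \<open>\<xi>\<close>, and \<open>\<eta>\<close> accounts for everything that is
  even, as well as for the difference between \<open>p B\<close> and the multiple of \<open>p\<close> already produced by \<open>\<xi>\<^sub>2\<close>.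
\<close>

lemma TAe_fold_map_superset:
  assumes p: "holo_fun_germ p"
  shows "odd_part_space k (fold_ideal p) \<subseteq> TAe (fold_map k p)"
proof
  fix g assume "g \<in> odd_part_space k (fold_ideal p)"
  then obtain z c0 c1 where g: "g = germ_of z" and z: "\<And>i. holo_fun_germ (\<lambda>v. z v $ i)"
    and c: "holo_fun_germ c0" "fold_ideal p c1"
    and z3: "\<forall>\<^sub>F v in nhds 0. z v $ 3 = c0 (square_snd v) + (v $ 2) ^ (2 * k + 1) * c1 (square_snd v)"
    by (auto simp: odd_part_space_def holo_map_germ_iff)
  obtain A B C where ABC: "holo_fun_germ A" "holo_fun_germ B" "holo_fun_germ C"
    and c1: "\<forall>\<^sub>F w in nhds 0. c1 w = partial_deriv 1 p w * A w + p w * B w + w $ 2 * partial_deriv 2 p w * C w"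
    using c(2) by (auto simp: fold_ideal_def)
  obtain a0 a1 where a: "holo_fun_germ a0" "holo_fun_germ a1" "\<forall>\<^sub>F v in nhds 0. z v $ 1 = a0 (square_snd v) + v $ 2 * a1 (square_snd v)"
    by (rule even_odd_decomposition[OF z[of 1]])
  obtain b0 b1 where b: "holo_fun_germ b0" "holo_fun_germ b1" "\<forall>\<^sub>F v in nhds 0. z v $ 2 = b0 (square_snd v) + v $ 2 * b1 (square_snd v)"
    by (rule even_odd_decomposition[OF z[of 2]])
  define \<xi> :: "complex^2 \<Rightarrow> complex^2" where
    "\<xi> v = vector [A (square_snd v) + v $ 2 * a1 (square_snd v), b1 (square_snd v) / 2 + v $ 2 * C (square_snd v) / 2]" for v
  define rest where "rest w = c0 w - (w $ 2) ^ (k + 1) * partial_deriv 1 p w * a1 w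
    - ((2 * of_nat k + 1) * (w $ 2) ^ k * p w + 2 * (w $ 2) ^ (k + 1) * partial_deriv 2 p w) * (b1 w / 2)" for w
  define s where "s w = B w - (2 * of_nat k + 1) * C w / 2" for w
  define pr :: "complex^3 \<Rightarrow> complex^2" where "pr w = vector [w $ 1, w $ 2]" for w
  define \<eta> :: "complex^3 \<Rightarrow> complex^3" where
    "\<eta> w = vector [a0 (pr w) - A (pr w), b0 (pr w) - w $ 2 * C (pr w), rest (pr w) + w $ 3 * s (pr w)]" for w
  have pr0: "pr 0 = 0" by (simp add: pr_def vec_eq_iff forall_2)
  have hpr: "holo_fun_germ (\<lambda>w. h (pr w))" if "holo_fun_germ h" for h
  proof (rule holo_germ_compose[where g = pr, OF that _ pr0])
    show "holo_fun_germ (\<lambda>w. pr w $ j)" for j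
      using exhaust_2[of j] by (auto simp: pr_def intro!: holo_germ)
  qed
  have pr_fold: "pr (fold_map k p v) = square_snd v" for v by (simp add: pr_def vec_eq_iff forall_2)
  have "holo_fun_germ rest" "holo_fun_germ s"
    unfolding rest_def s_def by (intro holo_germ holo_fun_germ_partial_deriv p a b c ABC)+
  then have "holo_map_germ \<eta>"
    unfolding \<eta>_def holo_map_germ_vector3 by (intro conjI holo_germ hpr a b ABC)
  moreover have "holo_map_germ \<xi>"
    unfolding \<xi>_def holo_map_germ_vector2 by (intro conjI holo_germ a b ABC)
  moreover have "g = germ_of (\<lambda>v. frechet_derivative (fold_map k p) (at v) (\<xi> v) + \<eta> (fold_map k p v))"
    unfolding g germ_of_eq_iff
    using z3 eventually_square_snd[OF c1] a(3) b(3) eventually_square_snd[OF p[unfolded holo_fun_germ_iff]]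
  proof eventually_elim
    case (elim v)
    show ?case
      unfolding vector3_eq_iff frechet_derivative_fold_map[OF elim(5)] vector_add_component \<eta>_def pr_fold vector_3 elim(1-4)
      unfolding \<xi>_def vector_2 rest_def s_def square_snd_simps fold_map_nth
      by (simp add: algebra_simps power_add power_mult power2_eq_square add_divide_distrib)
  qed
  ultimately show "g \<in> TAe (fold_map k p)" unfolding TAe_def by blast
qed

section \<open>Twisting the odd part\<close>

definition reflect :: "complex^2 \<Rightarrow> complex^2" where "reflect v = vector [v $ 1, - v $ 2]"

lemma reflect_simps [simp]: "reflect v $ 1 = v $ 1" "reflect v $ 2 = - v $ 2" "square_snd (reflect v) = square_snd v"
    "reflect (reflect v) = v"
  by (simp_all add: reflect_def square_snd_def vec_eq_iff forall_2)

lemma eventually_reflect: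
  assumes "\<forall>\<^sub>F w in nhds 0. P w"
  shows "\<forall>\<^sub>F v in nhds 0. P (reflect v)"
proof (rule eventually_compose_0[where g = reflect, OF assms], rule isCont_map)
  show "holo_fun_germ (\<lambda>w. reflect w $ j)" for j
    using exhaust_2[of j] by (auto intro!: holo_germ)
qed (simp add: vec_eq_iff forall_2)

text \<open>
  The odd part of the third component is multiplied by \<open>y^2\<close>. Even and odd parts are expressed through
  the reflection in \<open>y\<close>, which makes sense for all germs, so that the map is linear on the whole type.
\<close>

lift_definition twist_odd_part :: "(2, 3) germ \<Rightarrow> (2, 3) germ" is
  "\<lambda>h v. vector [h v $ 1, h v $ 2,
     (h v $ 3 + h (reflect v) $ 3) / 2 + (v $ 2)\<^sup>2 * ((h v $ 3 - h (reflect v) $ 3) / 2)]"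
proof -
  fix h k :: "complex^2 \<Rightarrow> complex^3"
  assume e: "\<forall>\<^sub>F x in nhds 0. h x = k x"
  show "\<forall>\<^sub>F v in nhds 0. (vector [h v $ 1, h v $ 2,
       (h v $ 3 + h (reflect v) $ 3) / 2 + (v $ 2)\<^sup>2 * ((h v $ 3 - h (reflect v) $ 3) / 2)] :: complex^3) =
     vector [k v $ 1, k v $ 2,
       (k v $ 3 + k (reflect v) $ 3) / 2 + (v $ 2)\<^sup>2 * ((k v $ 3 - k (reflect v) $ 3) / 2)]"
    using e eventually_reflect[OF e] by eventually_elim simp
qed

lemma twist_odd_part_add: "twist_odd_part (g + h) = twist_odd_part g + twist_odd_part h"
  by transfer (simp add: vector3_eq_iff field_simps)

lemma twist_odd_part_scale: "twist_odd_part (scale_germ c g) = scale_germ c (twist_odd_part g)"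
  by transfer (simp add: vector3_eq_iff field_simps)

text \<open>
  Off the axis \<open>y = 0\<close> the factor \<open>y^2\<close> can be cancelled; on the axis the odd part vanishes anyway.
\<close>

lemma twist_odd_part_eq_0: "twist_odd_part g = 0 \<Longrightarrow> g = 0"
proof transfer
  fix h :: "complex^2 \<Rightarrow> complex^3"
  let ?t = "\<lambda>v. (vector [h v $ 1, h v $ 2,
     (h v $ 3 + h (reflect v) $ 3) / 2 + (v $ 2)\<^sup>2 * ((h v $ 3 - h (reflect v) $ 3) / 2)] :: complex^3)"
  assume e: "\<forall>\<^sub>F v in nhds 0. ?t v = 0"
  show "\<forall>\<^sub>F v in nhds 0. h v = 0"
    using e eventually_reflect[OF e]
  proof eventually_elim
    case (elim v)
    define s d where "s = h v $ 3 + h (reflect v) $ 3" and "d = h v $ 3 - h (reflect v) $ 3"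
    have "s / 2 + (v $ 2)\<^sup>2 * (d / 2) = 0" using elim(1) by (simp add: vector3_eq_iff s_def d_def)
    moreover have "s / 2 - (v $ 2)\<^sup>2 * (d / 2) = 0"
      using elim(2) by (simp add: vector3_eq_iff s_def d_def field_simps)
    ultimately have s: "s = 0" and d: "(v $ 2)\<^sup>2 * d = 0" by (simp_all add: field_simps)
    have "d = 0"
    proof (cases "v $ 2 = 0")
      case True
      then have "reflect v = v" by (simp add: vec_eq_iff forall_2)
      then show ?thesis by (simp add: d_def)
    qed (use d in simp)
    with s have "h v $ 3 = 0" by (simp add: s_def d_def)
    then show ?case using elim(1) by (simp add: vector3_eq_iff)
  qed
qed

lemma inj_twist_odd_part: "inj twist_odd_part"
proof (rule injI)
  fix g h assume "twist_odd_part g = twist_odd_part h"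
  moreover have "twist_odd_part g = twist_odd_part (g - h) + twist_odd_part h" using twist_odd_part_add[of "g - h" h] by simp
  ultimately have "twist_odd_part (g - h) = 0" by simp
  then show "g = h" using twist_odd_part_eq_0 by force
qed

lemma twist_odd_part_odd_part_space: "twist_odd_part ` odd_part_space 0 N = odd_part_space 1 N"
proof -
  have tw: "twist_odd_part (germ_of z) = germ_of z'"
    if z: "\<forall>\<^sub>F v in nhds 0. z v $ 3 = c0 (square_snd v) + v $ 2 * c1 (square_snd v)"
      and z': "\<forall>\<^sub>F v in nhds 0. z' v $ 3 = c0 (square_snd v) + (v $ 2) ^ 3 * c1 (square_snd v)"
      and same: "\<And>v. z' v $ 1 = z v $ 1" "\<And>v. z' v $ 2 = z v $ 2" for z z' c0 c1
    unfolding twist_odd_part.abs_eq germ_of_eq_iff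
    using z eventually_reflect[OF z] z'
  proof eventually_elim
    case (elim v)
    show ?case unfolding vector3_eq_iff vector_3 same elim reflect_simps
      by (simp add: field_simps power3_eq_cube power2_eq_square)
  qed
  have holo: "holo_map_germ (\<lambda>v. vector [z v $ 1, z v $ 2, c0 (square_snd v) + (v $ 2) ^ m * c1 (square_snd v)] :: complex^3)"
    if "holo_map_germ z" "holo_fun_germ c0" "holo_fun_germ c1" for c0 c1 m and z :: "complex^2 \<Rightarrow> complex^3"
    unfolding holo_map_germ_vector3 using that(1)[unfolded holo_map_germ_iff] by (intro conjI holo_germ that(2,3)) auto
  show ?thesis
  proof (rule equalityI; rule subsetI)
    fix g assume "g \<in> twist_odd_part ` odd_part_space 0 N"
    then obtain z c0 c1 where z: "g = twist_odd_part (germ_of z)" "holo_map_germ z" "holo_fun_germ c0" "holo_fun_germ c1" "N c1"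
      "\<forall>\<^sub>F v in nhds 0. z v $ 3 = c0 (square_snd v) + v $ 2 * c1 (square_snd v)"
      by (auto simp: odd_part_space_def)
    let ?z = "\<lambda>v. vector [z v $ 1, z v $ 2, c0 (square_snd v) + (v $ 2) ^ 3 * c1 (square_snd v)] :: complex^3"
    have "g = germ_of ?z"
      unfolding z(1) by (rule tw[OF z(6)]) simp_all
    then show "g \<in> odd_part_space 1 N"
      unfolding odd_part_space_def using z(5) holo[OF z(2-4), of 3]
      by (intro CollectI exI[of _ ?z] exI[of _ c0] exI[of _ c1] conjI z) simp_all
  next
    fix g assume "g \<in> odd_part_space 1 N"
    then obtain z c0 c1 where z: "g = germ_of z" "holo_map_germ z" "holo_fun_germ c0" "holo_fun_germ c1" "N c1"
      "\<forall>\<^sub>F v in nhds 0. z v $ 3 = c0 (square_snd v) + (v $ 2) ^ 3 * c1 (square_snd v)"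
      by (auto simp: odd_part_space_def numeral_3_eq_3)
    let ?z = "\<lambda>v. vector [z v $ 1, z v $ 2, c0 (square_snd v) + v $ 2 * c1 (square_snd v)] :: complex^3"
    have "twist_odd_part (germ_of ?z) = g"
      unfolding z(1) by (rule tw[OF _ z(6)]) simp_all
    moreover have "germ_of ?z \<in> odd_part_space 0 N"
      unfolding odd_part_space_def using z holo[OF z(2-4), of 1]
      by (intro CollectI exI[of _ ?z] conjI refl exI[of _ c0] exI[of _ c1]) auto
    ultimately show "g \<in> twist_odd_part ` odd_part_space 0 N" by blast
  qed
qed

lemma germ_subspace_odd_part_space:
  assumes N0: "N (\<lambda>_. 0)" and Nadd: "\<And>c d. N c \<Longrightarrow> N d \<Longrightarrow> N (\<lambda>w. c w + d w)"
    and Nscale: "\<And>a c. N c \<Longrightarrow> N (\<lambda>w. a * c w)"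
  shows "germ_subspace (odd_part_space k N)"
proof -
  have "0 \<in> odd_part_space k N"
    unfolding odd_part_space_def zero_germ.abs_eq
    by (intro CollectI exI[of _ "\<lambda>_. 0"] conjI refl) (auto simp: holo_map_germ_iff N0 intro: holo_germ)
  moreover have "g + h \<in> odd_part_space k N" if gh: "g \<in> odd_part_space k N" "h \<in> odd_part_space k N" for g h
  proof -
    obtain z c0 c1 where z: "g = germ_of z" "holo_map_germ z" "holo_fun_germ c0" "holo_fun_germ c1" "N c1"
      "\<forall>\<^sub>F v in nhds 0. z v $ 3 = c0 (square_snd v) + (v $ 2) ^ (2 * k + 1) * c1 (square_snd v)"
      using gh(1) by (auto simp: odd_part_space_def)
    obtain y d0 d1 where y: "h = germ_of y" "holo_map_germ y" "holo_fun_germ d0" "holo_fun_germ d1" "N d1"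
      "\<forall>\<^sub>F v in nhds 0. y v $ 3 = d0 (square_snd v) + (v $ 2) ^ (2 * k + 1) * d1 (square_snd v)"
      using gh(2) by (auto simp: odd_part_space_def)
    have "\<forall>\<^sub>F v in nhds 0. z v $ 3 + y v $ 3 = c0 (square_snd v) + d0 (square_snd v) + (v $ 2) ^ (2 * k + 1) * (c1 (square_snd v) + d1 (square_snd v))"
      using z(6) y(6) by eventually_elim (simp add: algebra_simps)
    moreover have "holo_map_germ (\<lambda>v. z v + y v)"
      using z(2) y(2) by (auto simp: holo_map_germ_iff intro: holo_germ)
    ultimately show ?thesis
      unfolding odd_part_space_def z(1) y(1) plus_germ.abs_eq
      by (intro CollectI exI[of _ "\<lambda>v. z v + y v"] conjI refl exI[of _ "\<lambda>w. c0 w + d0 w"] exI[of _ "\<lambda>w. c1 w + d1 w"])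
        (simp_all add: holo_germ z y Nadd)
  qed
  moreover have "scale_germ a g \<in> odd_part_space k N" if g: "g \<in> odd_part_space k N" for a g
  proof -
    obtain z c0 c1 where z: "g = germ_of z" "holo_map_germ z" "holo_fun_germ c0" "holo_fun_germ c1" "N c1"
      "\<forall>\<^sub>F v in nhds 0. z v $ 3 = c0 (square_snd v) + (v $ 2) ^ (2 * k + 1) * c1 (square_snd v)"
      using g by (auto simp: odd_part_space_def)
    have "\<forall>\<^sub>F v in nhds 0. a * z v $ 3 = a * c0 (square_snd v) + (v $ 2) ^ (2 * k + 1) * (a * c1 (square_snd v))"
      using z(6) by eventually_elim (simp add: algebra_simps)
    moreover have "holo_map_germ (\<lambda>v. a *s z v)"
      using z(2) by (auto simp: holo_map_germ_iff intro: holo_germ)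
    ultimately show ?thesis
      unfolding odd_part_space_def z(1) scale_germ.abs_eq
      by (intro CollectI exI[of _ "\<lambda>v. a *s z v"] conjI refl exI[of _ "\<lambda>w. a * c0 w"] exI[of _ "\<lambda>w. a * c1 w"])
        (simp_all add: holo_germ z Nscale)
  qed
  ultimately show ?thesis by (auto simp: germ_subspace_def)
qed

lemma germ_subspace_fold_ideal: "germ_subspace (odd_part_space k (fold_ideal p))"
proof (rule germ_subspace_odd_part_space)
  show "fold_ideal p (\<lambda>_. 0)"
    unfolding fold_ideal_def by (intro exI[of _ "\<lambda>_. 0"]) (simp add: holo_germ)
next
  fix c d assume "fold_ideal p c" "fold_ideal p d"
  then obtain A B C A' B' C' where h: "holo_fun_germ A" "holo_fun_germ B" "holo_fun_germ C"
      "holo_fun_germ A'" "holo_fun_germ B'" "holo_fun_germ C'"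
    and e: "\<forall>\<^sub>F w in nhds 0. c w = partial_deriv 1 p w * A w + p w * B w + w $ 2 * partial_deriv 2 p w * C w"
      "\<forall>\<^sub>F w in nhds 0. d w = partial_deriv 1 p w * A' w + p w * B' w + w $ 2 * partial_deriv 2 p w * C' w"
    unfolding fold_ideal_def by blast
  have "\<forall>\<^sub>F w in nhds 0. c w + d w = partial_deriv 1 p w * (A w + A' w) + p w * (B w + B' w) + w $ 2 * partial_deriv 2 p w * (C w + C' w)"
    using e by eventually_elim (simp add: algebra_simps)
  then show "fold_ideal p (\<lambda>w. c w + d w)"
    unfolding fold_ideal_def
    by (intro exI[of _ "\<lambda>w. A w + A' w"] exI[of _ "\<lambda>w. B w + B' w"] exI[of _ "\<lambda>w. C w + C' w"] conjI holo_germ h)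
next
  fix a c assume "fold_ideal p c"
  then obtain A B C where h: "holo_fun_germ A" "holo_fun_germ B" "holo_fun_germ C"
    and e: "\<forall>\<^sub>F w in nhds 0. c w = partial_deriv 1 p w * A w + p w * B w + w $ 2 * partial_deriv 2 p w * C w"
    unfolding fold_ideal_def by blast
  have "\<forall>\<^sub>F w in nhds 0. a * c w = partial_deriv 1 p w * (a * A w) + p w * (a * B w) + w $ 2 * partial_deriv 2 p w * (a * C w)"
    using e by eventually_elim (simp add: algebra_simps)
  then show "fold_ideal p (\<lambda>w. a * c w)"
    unfolding fold_ideal_def
    by (intro exI[of _ "\<lambda>w. a * A w"] exI[of _ "\<lambda>w. a * B w"] exI[of _ "\<lambda>w. a * C w"] conjI
        holo_germ_mult[OF holo_germ_const] h)
qed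

text \<open>
  By the even-odd decomposition of the third component.
\<close>

lemma theta_eq_odd_part_space: "theta g = germ_space (odd_part_space 0 (\<lambda>_. True))"
proof -
  have "\<exists>c0 c1. holo_fun_germ c0 \<and> holo_fun_germ c1 \<and> (\<forall>\<^sub>F v in nhds 0. h v $ 3 = c0 (square_snd v) + v $ 2 * c1 (square_snd v))"
    if "holo_map_germ h" for h :: "complex^2 \<Rightarrow> complex^3"
  proof -
    have h3: "holo_fun_germ (\<lambda>v. h v $ 3)" using that by (simp add: holo_map_germ_iff)
    show ?thesis by (rule even_odd_decomposition[OF h3]) blast
  qed
  then have "{germ_of h | h :: complex^2 \<Rightarrow> complex^3. holo_map_germ h} = odd_part_space 0 (\<lambda>_. True)"
    unfolding odd_part_space_def by auto
  then show ?thesis by (simp add: theta_def germ_space_def)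
qed

section \<open>Infinitesimal frontal deformations: the necessary condition\<close>

lemma sum_UNIV_option: "(\<Sum>i\<in>UNIV. f i) = f None + (\<Sum>i\<in>(UNIV :: 'a::finite set). f (Some i))"
  by (simp add: UNIV_option_conv sum.reindex)

lemma forall_option: "(\<forall>i. P i) \<longleftrightarrow> P None \<and> (\<forall>i. P (Some i))"
  by (metis option.exhaust)

text \<open>
  The inclusion of the parameter value zero into the source of an unfolding.
\<close>

definition zero_slice :: "complex^'n \<Rightarrow> complex^('n::finite option)" where
  "zero_slice v = (\<chi> j. case j of None \<Rightarrow> 0 | Some k \<Rightarrow> v $ k)"

definition drop_param :: "complex^('n option) \<Rightarrow> complex^('n::finite)" where
  "drop_param w = (\<chi> k. w $ Some k)"

lemma slice_drop_param_simps [simp]: "zero_slice v $ None = 0" "zero_slice v $ Some k = v $ k" "drop_param w $ k = w $ Some k"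
  "zero_slice 0 = 0" "drop_param 0 = 0" "drop_param (zero_slice v) = v"
  by (simp_all add: zero_slice_def drop_param_def vec_eq_iff split: option.split)

lemma unfolding_map_None [simp]: "unfolding_map G w $ None = w $ None"
  and unfolding_map_Some: "unfolding_map G w $ Some i = G (w $ None) (drop_param w) $ i"
  by (simp_all add: unfolding_map_def drop_param_def)

lemma holo_slice: "holo_fun_germ (\<lambda>v. zero_slice v $ j)"
  by (cases j) (simp_all add: holo_germ_const holo_germ_coord)

lemma holo_germ_slice: "holo_fun_germ h \<Longrightarrow> holo_fun_germ (\<lambda>v. h (zero_slice v))"
  by (rule holo_germ_compose[where g = zero_slice]) (simp_all add: holo_slice)

lemma eventually_slice:
  "\<forall>\<^sub>F w in nhds 0. P w \<Longrightarrow> \<forall>\<^sub>F v in nhds 0. P (zero_slice v)"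
  by (rule eventually_compose_0[where g = zero_slice]) (simp_all add: isCont_map holo_slice)

lemma holo_germ_drop_param: "holo_fun_germ h \<Longrightarrow> holo_fun_germ (\<lambda>w. h (drop_param w))"
  by (rule holo_germ_compose[where g = drop_param]) (simp_all add: holo_germ_coord)

lemma partial_deriv_slice:
  assumes "cdiff_at h (zero_slice v)"
  shows "cdiff_at (\<lambda>v. h (zero_slice v)) v" "partial_deriv k (\<lambda>v. h (zero_slice v)) v = partial_deriv (Some k) h (zero_slice v)"
proof -
  have c: "cdiff_at (\<lambda>v. zero_slice v $ j) v" for j by (cases j) simp_all
  show "cdiff_at (\<lambda>v. h (zero_slice v)) v" by (rule cdiff_compose[where g = zero_slice, OF assms c])
  show "partial_deriv k (\<lambda>v. h (zero_slice v)) v = partial_deriv (Some k) h (zero_slice v)"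
    by (subst partial_deriv_compose[where g = zero_slice, OF assms c])
       (simp add: sum_UNIV_option partial_deriv_coord if_distrib cong: if_cong)
qed

lemma deriv_eq_partial_deriv_None:
  assumes "cdiff_at (\<lambda>w. unfolding_map G w $ Some i) (zero_slice v)"
  shows "deriv (\<lambda>t. G t v $ i) 0 = partial_deriv None (\<lambda>w. unfolding_map G w $ Some i) (zero_slice v)"
proof (rule DERIV_imp_deriv)
  have "zero_slice v + t *s axis None 1 = (\<chi> j. case j of None \<Rightarrow> t | Some k \<Rightarrow> v $ k)" for t
    by (simp add: vec_eq_iff zero_slice_def axis_def split: option.split)
  moreover have "drop_param (\<chi> j. case j of None \<Rightarrow> t | Some k \<Rightarrow> v $ k) = v" for t
    by (simp add: vec_eq_iff)
  ultimately have eq: "unfolding_map G (zero_slice v + t *s axis None 1) $ Some i = G t v $ i" for t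
    by (simp add: unfolding_map_Some)
  show "((\<lambda>t. G t v $ i) has_field_derivative partial_deriv None (\<lambda>w. unfolding_map G w $ Some i) (zero_slice v)) (at 0)"
    using cdiff_line[of "\<lambda>w. unfolding_map G w $ Some i" "zero_slice v" 0 None] assms
    unfolding eq by simp
qed

text \<open>
  The conormal form is tested on the constant coordinate fields.
\<close>

lemma frontal_on_relations:
  assumes fr: "\<And>\<xi>. holo_map \<xi> U \<Longrightarrow>
       (\<forall>x\<in>U. (\<Sum>i\<in>UNIV. \<nu> x $ i * frechet_derivative g (at x) (\<xi> x) $ i) = 0)"
    and g: "holo_map g U" and w: "w \<in> U"
  shows "(\<Sum>i\<in>UNIV. \<nu> w $ i * partial_deriv j (\<lambda>w. g w $ i) w) = 0"
proof -
  have "cdiff_at (\<lambda>w. g w $ i) w" for i using g w by (auto simp: holo_map_def holo_fun_iff_cdiff)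
  then have "frechet_derivative g (at w) (axis j 1) $ i = partial_deriv j (\<lambda>w. g w $ i) w" for i
    by (subst frechet_derivative_nth) (simp_all add: axis_def if_distrib cong: if_cong)
  moreover have "holo_map (\<lambda>_. axis j 1) U" by (simp add: holo_map_def holo_fun_iff_cdiff)
  then have "(\<Sum>i\<in>UNIV. \<nu> w $ i * frechet_derivative g (at w) (axis j 1) $ i) = 0"
    using fr[of "\<lambda>_. axis j 1"] w by blast
  ultimately show ?thesis by simp
qed

text \<open>
  Let \<open>\<nu>\<close> be the conormal form of the unfolding and \<open>z\<close> its velocity at \<open>t = 0\<close>. On \<open>t = 0\<close> the
  conditions on \<open>\<nu>\<close> read \<open>\<nu>\<^sub>1 + y^3 p_X \<nu>\<^sub>3 = 0\<close> and \<open>2 y \<nu>\<^sub>2 + y^2 S = 0\<close> with \<open>S\<close> holomorphic, so \<open>\<nu>\<^sub>1\<close> and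
  \<open>\<nu>\<^sub>2\<close> vanish on the axis \<open>y = 0\<close>. Then \<open>\<nu>\<^sub>3\<close> cannot vanish there, because the coefficient of \<open>dt\<close> is a
  combination of the others. Finally \<open>\<Sum>i. \<nu>\<^sub>i \<partial>G\<^sub>i/\<partial>y = 0\<close> is differentiated in \<open>t\<close> at points of the axis: the
  terms with derivatives of \<open>\<nu>\<close> drop out since \<open>\<partial>f\<^sub>1/\<partial>y\<close> is zero there, and
  \<open>\<nu>\<^sub>3 \<partial>z\<^sub>3/\<partial>y = 0\<close> is left after exchanging the derivatives in \<open>t\<close> and \<open>y\<close>.
\<close>

lemma frontal_deformation_partial_deriv:
  assumes p: "holo_fun_germ p"
    and G0: "\<forall>\<^sub>F v in nhds 0. G 0 v = fold_map 1 p v"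
    and fr: "frontal_germ (unfolding_map G)"
  defines "z \<equiv> (\<lambda>v. (\<chi> i. deriv (\<lambda>t. G t v $ i) 0) :: complex^3)"
  shows "holo_map_germ z" and "\<forall>\<^sub>F v in nhds 0. v $ 2 = 0 \<longrightarrow> partial_deriv 2 (\<lambda>v. z v $ 3) v = 0"
proof -
  obtain U \<nu> where U: "open U" "0 \<in> U" and hG: "holo_map (unfolding_map G) U"
    and h\<nu>: "holo_map \<nu> U" and \<nu>0: "\<And>w. w \<in> U \<Longrightarrow> \<nu> w \<noteq> 0"
    and rel: "\<And>\<xi>. holo_map \<xi> U \<Longrightarrow>
       (\<forall>x\<in>U. (\<Sum>i\<in>UNIV. \<nu> x $ i * frechet_derivative (unfolding_map G) (at x) (\<xi> x) $ i) = 0)"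
    using fr unfolding frontal_germ_def frontal_on_def by blast
  define g where "g i w = unfolding_map G w $ Some i" for i w
  have cg: "cdiff_at (g i) w" if "w \<in> U" for i w
    using hG that unfolding holo_map_def holo_fun_iff_cdiff g_def[abs_def] by blast
  have c\<nu>: "cdiff_at (\<lambda>w. \<nu> w $ j) w" if "w \<in> U" for j w
    using h\<nu> that by (auto simp: holo_map_def holo_fun_iff_cdiff)
  have evU: "\<forall>\<^sub>F y in nhds w. y \<in> U" if "w \<in> U" for w using eventually_nhds_in_open[OF U(1) that] .
  have cpg: "cdiff_at (partial_deriv j (g i)) w" if "w \<in> U" for i j w
    by (rule cdiff_partial_deriv) (use evU[OF that] in \<open>auto elim!: eventually_mono intro: cg\<close>)
  have hg: "holo_fun_germ (g i)" for i
    unfolding holo_fun_germ_iff using evU[OF U(2)] by (auto elim!: eventually_mono intro: cg)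
  have evS: "\<forall>\<^sub>F v in nhds 0. zero_slice v \<in> U" using eventually_slice[OF evU[OF U(2)]] .
  have z: "\<forall>\<^sub>F v in nhds 0. z v $ i = partial_deriv None (g i) (zero_slice v)" for i
    using evS by (rule eventually_mono) (auto simp: z_def g_def[abs_def] intro!: deriv_eq_partial_deriv_None cg[unfolded g_def[abs_def]])
  have "holo_fun_germ (\<lambda>v. z v $ i)" for i
    using holo_germ_cong[OF z[of i]] holo_germ_slice[OF holo_fun_germ_partial_deriv[OF hg]] by blast
  then show "holo_map_germ z" by (simp add: holo_map_germ_iff)
  have R: "(\<Sum>i\<in>UNIV. \<nu> w $ Some i * partial_deriv (Some k) (g i) w) = 0" 
    "\<nu> w $ None + (\<Sum>i\<in>UNIV. \<nu> w $ Some i * partial_deriv None (g i) w) = 0" if "w \<in> U" for w k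
    using frontal_on_relations[OF rel hG that, of "Some k"] frontal_on_relations[OF rel hG that, of None]
    by (simp_all add: sum_UNIV_option partial_deriv_coord g_def[abs_def])
  define S where "S v = \<nu> (zero_slice v) $ Some 3 * (3 * p (square_snd v) + 2 * (v $ 2)\<^sup>2 * partial_deriv 2 p (square_snd v))" for v
  have pg: "\<forall>\<^sub>F v in nhds 0. \<forall>k i. partial_deriv (Some k) (g i) (zero_slice v) = partial_deriv k (\<lambda>v. fold_map 1 p v $ i) v"
  proof -
    have "\<forall>\<^sub>F v in nhds 0. \<forall>\<^sub>F y in nhds v. G 0 y = fold_map 1 p y" using G0 by (simp add: eventually_eventually)
    then show ?thesis using evS
    proof eventually_elim
      case (elim v)
      have "partial_deriv (Some k) (g i) (zero_slice v) = partial_deriv k (\<lambda>v. fold_map 1 p v $ i) v" for k i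
      proof -
        have e: "\<forall>\<^sub>F y in nhds v. g i (zero_slice y) = fold_map 1 p y $ i"
          using elim(1) by (rule eventually_mono) (simp add: g_def unfolding_map_Some)
        show ?thesis
          using partial_deriv_slice(2)[OF cg[OF elim(2), of i], of k]
            partial_deriv_cong[OF e partial_deriv_slice(1)[OF cg[OF elim(2), of i]], of k] by simp
      qed
      then show ?case by blast
    qed
  qed
  have cp: "\<forall>\<^sub>F v in nhds 0. cdiff_at p (square_snd v)" using eventually_square_snd[OF p[unfolded holo_fun_germ_iff]] .
  have fd: "\<forall>\<^sub>F v in nhds 0. 
      partial_deriv 1 (\<lambda>v. fold_map 1 p v $ 1) v = 1 \<and> partial_deriv 1 (\<lambda>v. fold_map 1 p v $ 2) v = 0 \<and>
      partial_deriv 1 (\<lambda>v. fold_map 1 p v $ 3) v = (v $ 2) ^ 3 * partial_deriv 1 p (square_snd v) \<and>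
      partial_deriv 2 (\<lambda>v. fold_map 1 p v $ 1) v = 0 \<and> partial_deriv 2 (\<lambda>v. fold_map 1 p v $ 2) v = 2 * v $ 2 \<and>
      partial_deriv 2 (\<lambda>v. fold_map 1 p v $ 3) v = (v $ 2)\<^sup>2 * (3 * p (square_snd v) + 2 * (v $ 2)\<^sup>2 * partial_deriv 2 p (square_snd v))"
    using cp
  proof eventually_elim
    case (elim v)
    have c: "cdiff_at (\<lambda>w. fold_map 1 p w $ j) v" for j
      using exhaust_3[of j] partial_deriv_square_snd(1)[OF elim] by auto
    have "partial_deriv k (\<lambda>w. fold_map 1 p w $ i) v = frechet_derivative (fold_map 1 p) (at v) (axis k 1) $ i" for k i
      by (subst frechet_derivative_nth[OF c]) (simp add: axis_def if_distrib cong: if_cong)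
    then show ?case
      by (simp only: frechet_derivative_fold_map[OF elim] vector_3)
         (simp add: axis_def power3_eq_cube power2_eq_square algebra_simps eval_nat_numeral)
  qed
  have "\<forall>\<^sub>F v in nhds 0. 2 * v $ 2 * \<nu> (zero_slice v) $ Some 2 + (v $ 2)\<^sup>2 * S v = 0"
    using pg fd evS
  proof eventually_elim
    case (elim v)
    show ?case using R(1)[OF elim(3), of 2] elim(1,2)
      by (simp add: sum_3 S_def algebra_simps)
  qed
  then have eq2: "\<forall>\<^sub>F v in nhds 0. \<forall>\<^sub>F y in nhds v. 2 * y $ 2 * \<nu> (zero_slice y) $ Some 2 + (y $ 2)\<^sup>2 * S y = 0"
    by (simp add: eventually_eventually)
  have "holo_fun_germ (\<lambda>w. \<nu> w $ Some 3)"
    unfolding holo_fun_germ_iff using evU[OF U(2)] by (rule eventually_mono) (rule c\<nu>)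
  moreover have "holo_fun_germ (\<lambda>v. 3 * p (square_snd v) + 2 * (v $ 2)\<^sup>2 * partial_deriv 2 p (square_snd v))"
    by (intro holo_germ p holo_fun_germ_partial_deriv)
  ultimately have "holo_fun_germ S"
    unfolding S_def by (intro holo_germ_mult holo_germ_slice[where h = "\<lambda>w. \<nu> w $ Some 3"])
  then have cS: "\<forall>\<^sub>F v in nhds 0. cdiff_at S v" by (simp add: holo_fun_germ_iff)
  have zz: "\<forall>\<^sub>F v in nhds 0. \<forall>\<^sub>F y in nhds v. z y $ 3 = partial_deriv None (g 3) (zero_slice y)"
    using z[of 3] by (simp add: eventually_eventually)
  show "\<forall>\<^sub>F v in nhds 0. v $ 2 = 0 \<longrightarrow> partial_deriv 2 (\<lambda>v. z v $ 3) v = 0"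
    using pg fd evS eq2 cS zz
  proof (eventually_elim, intro impI)
    case (elim v)
    assume v: "v $ 2 = 0"
    let ?w = "zero_slice v"
    note w = elim(3)
    have \<nu>1: "\<nu> ?w $ Some 1 = 0"
      using R(1)[OF w, of 1] elim(1,2) v by (simp add: sum_3)
    \<comment> \<open>The relation \<open>2 y \<nu>\<^sub>2 + y^2 S = 0\<close> is differentiated in \<open>y\<close> at \<open>y = 0\<close>.\<close>
    have \<nu>2: "\<nu> ?w $ Some 2 = 0"
    proof -
      note c2 = partial_deriv_slice(1)[of "\<lambda>w. \<nu> w $ Some 2", OF c\<nu>[OF w]]
      have cy: "cdiff_at (\<lambda>y. 2 * y $ 2 * \<nu> (zero_slice y) $ Some 2) v" using c2 by simp
      have cq: "cdiff_at (\<lambda>y. (y $ 2)\<^sup>2 * S y) v" using elim(5) by simp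
      have "partial_deriv 2 (\<lambda>y. 2 * y $ 2 * \<nu> (zero_slice y) $ Some 2 + (y $ 2)\<^sup>2 * S y) v = 0"
        using partial_deriv_cong[OF elim(4), of 2] cdiff_add[OF cy cq] by simp
      moreover have "partial_deriv 2 (\<lambda>y. 2 * y $ 2 * \<nu> (zero_slice y) $ Some 2) v = 2 * \<nu> ?w $ Some 2"
        using v c2 by (simp add: partial_deriv_mult partial_deriv_coord)
      moreover have "partial_deriv 2 (\<lambda>y. (y $ 2)\<^sup>2 * S y) v = 0"
        using v elim(5) by (simp add: partial_deriv_mult power2_eq_square)
      ultimately show ?thesis by (simp add: partial_deriv_add[OF cy cq])
    qed
    have \<nu>3: "\<nu> ?w $ Some 3 \<noteq> 0"
    proof
      assume "\<nu> ?w $ Some 3 = 0"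
      with \<nu>1 \<nu>2 have "\<nu> ?w $ Some i = 0" for i using exhaust_3[of i] by auto
      moreover from this have "\<nu> ?w $ None = 0" using R(2)[OF w] by simp
      ultimately have "\<nu> ?w = 0" by (simp add: vec_eq_iff forall_option)
      with \<nu>0[OF w] show False by simp
    qed
    have "\<forall>\<^sub>F y in nhds ?w. (\<Sum>i\<in>UNIV. \<nu> y $ Some i * partial_deriv (Some 2) (g i) y) = 0"
      using evU[OF w] by (rule eventually_mono) (rule R(1))
    moreover have cc: "cdiff_at (\<lambda>y. \<nu> y $ Some i * partial_deriv (Some 2) (g i) y) ?w" for i
      by (rule cdiff_mult[OF c\<nu>[OF w] cpg[OF w]])
    ultimately have "partial_deriv None (\<lambda>y. \<Sum>i\<in>UNIV. \<nu> y $ Some i * partial_deriv (Some 2) (g i) y) ?w = 0"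
      using partial_deriv_cong[of _ "\<lambda>_. 0" ?w None] cdiff_sum[of UNIV] by simp
    moreover have "partial_deriv (Some 2) (g i) ?w = 0" for i
      using exhaust_3[of i] elim(1,2) v by auto
    ultimately have "(\<Sum>i\<in>UNIV. \<nu> ?w $ Some i * partial_deriv None (partial_deriv (Some 2) (g i)) ?w) = 0"
      by (simp add: partial_deriv_sum[OF cc] partial_deriv_mult[OF c\<nu>[OF w] cpg[OF w]])
    then have "partial_deriv None (partial_deriv (Some 2) (g 3)) ?w = 0" using \<nu>1 \<nu>2 \<nu>3 by (simp add: sum_3)
    moreover have "\<forall>\<^sub>F y in nhds ?w. cdiff_at (g 3) y"
      using evU[OF w] by (rule eventually_mono) (rule cg)
    ultimately have "partial_deriv (Some 2) (partial_deriv None (g 3)) ?w = 0" by (simp add: partial_deriv_commute)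
    moreover have "partial_deriv 2 (\<lambda>v. z v $ 3) v = partial_deriv 2 (\<lambda>v. partial_deriv None (g 3) (zero_slice v)) v"
      using cdiff_transform(2)[OF partial_deriv_slice(1)[OF cpg[OF w]]] elim(6) by (simp add: eq_commute)
    ultimately show "partial_deriv 2 (\<lambda>v. z v $ 3) v = 0" by (simp add: partial_deriv_slice(2)[OF cpg[OF w]])
  qed
qed

text \<open>
  For \<open>h = c0(x,y^2) + y c(x,y^2)\<close> the derivative in \<open>y\<close> equals \<open>c(x,0)\<close> on the axis, so \<open>c\<close> vanishes
  where its second argument does and is divisible by it.
\<close>

lemma odd_part_divisible:
  assumes h: "holo_fun_germ h" and 0: "\<forall>\<^sub>F v in nhds 0. v $ 2 = 0 \<longrightarrow> partial_deriv 2 h v = 0"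
  obtains c0 c1 where "holo_fun_germ c0" "holo_fun_germ c1"
    "\<forall>\<^sub>F v in nhds 0. h v = c0 (square_snd v) + (v $ 2) ^ 3 * c1 (square_snd v)"
proof -
  obtain c0 c where c: "holo_fun_germ c0" "holo_fun_germ c"
    and e: "\<forall>\<^sub>F v in nhds 0. h v = c0 (square_snd v) + v $ 2 * c (square_snd v)"
    by (rule even_odd_decomposition[OF h])
  obtain c1 where c1: "holo_fun_germ c1" "\<forall>\<^sub>F w in nhds 0. c w = c (upd_coord 2 w 0) + w $ 2 * c1 w"
    by (rule hadamard[OF c(2), of 2])
  have ee: "\<forall>\<^sub>F v in nhds 0. \<forall>\<^sub>F y in nhds v. h y = c0 (square_snd y) + y $ 2 * c (square_snd y)"
    using e by (simp add: eventually_eventually)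
  have "\<forall>\<^sub>F v in nhds 0. v $ 2 = 0 \<longrightarrow> c v = 0"
    using 0 eventually_square_snd[OF c(1)[unfolded holo_fun_germ_iff]] eventually_square_snd[OF c(2)[unfolded holo_fun_germ_iff]]
      ee
  proof (eventually_elim, intro impI)
    case (elim v)
    assume v: "v $ 2 = 0"
    then have s: "square_snd v = v" by (simp add: vec_eq_iff forall_2)
    note c1 = partial_deriv_square_snd[OF elim(2)] and c2 = partial_deriv_square_snd[OF elim(3)]
    have cy: "cdiff_at (\<lambda>v. v $ 2 * c (square_snd v)) v" by (rule cdiff_mult[OF cdiff_coord c2(1)])
    have "partial_deriv 2 h v = partial_deriv 2 (\<lambda>v. c0 (square_snd v) + v $ 2 * c (square_snd v)) v"
    proof (rule cdiff_transform(2)[OF cdiff_add[OF c1(1) cy]])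
      show "\<forall>\<^sub>F y in nhds v. c0 (square_snd y) + y $ 2 * c (square_snd y) = h y"
        using elim(4) by (rule eventually_mono) simp
    qed
    also have "\<dots> = partial_deriv 2 (\<lambda>v. c0 (square_snd v)) v + (v $ 2 * partial_deriv 2 (\<lambda>v. c (square_snd v)) v + partial_deriv 2 (\<lambda>v. v $ 2) v * c (square_snd v))"
      by (simp only: partial_deriv_add[OF c1(1) cy] partial_deriv_mult[OF cdiff_coord c2(1)])
    also have "\<dots> = c v" by (simp add: c1(3) v partial_deriv_coord s)
    finally show "c v = 0" using elim(1) v by simp
  qed
  then have "\<forall>\<^sub>F w in nhds 0. upd_coord 2 w 0 $ 2 = 0 \<longrightarrow> c (upd_coord 2 w 0) = 0"
  proof (rule eventually_compose_0[where g = "\<lambda>w. upd_coord 2 w 0"])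
    show "isCont (\<lambda>w :: complex^2. upd_coord 2 w 0) 0"
    proof (rule isCont_map)
      show "holo_fun_germ (\<lambda>w :: complex^2. upd_coord 2 w 0 $ j)" for j
        using exhaust_2[of j] by (auto intro: holo_germ_const holo_germ_coord)
    qed
  qed (simp add: vec_eq_iff)
  then have "\<forall>\<^sub>F w in nhds 0. c w = w $ 2 * c1 w"
    using c1(2) by eventually_elim simp
  from eventually_square_snd[OF this] e
  have "\<forall>\<^sub>F v in nhds 0. h v = c0 (square_snd v) + (v $ 2) ^ 3 * c1 (square_snd v)"
    by eventually_elim (simp add: power2_eq_square power3_eq_cube)
  then show ?thesis using that c(1) c1(1) by blast
qed

lemma frontal_deformations_subset:
  assumes p: "holo_fun_germ p"
  shows "frontal_deformations (fold_map 1 p) \<subseteq> odd_part_space 1 (\<lambda>_. True)"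
proof
  fix g assume "g \<in> frontal_deformations (fold_map 1 p)"
  then obtain G where g: "g = germ_of (\<lambda>x. \<chi> i. deriv (\<lambda>t. G t x $ i) 0)"
    and G: "\<forall>\<^sub>F x in nhds 0. G 0 x = fold_map 1 p x" "frontal_germ (unfolding_map G)"
    by (auto simp: frontal_deformations_def)
  define z where "z v = ((\<chi> i. deriv (\<lambda>t. G t v $ i) 0) :: complex^3)" for v
  note z = frontal_deformation_partial_deriv[OF p G, folded z_def]
  have "holo_fun_germ (\<lambda>v. z v $ 3)" using z(1) by (simp add: holo_map_germ_iff)
  then obtain c0 c1 where "holo_fun_germ c0" "holo_fun_germ c1"
    "\<forall>\<^sub>F v in nhds 0. z v $ 3 = c0 (square_snd v) + (v $ 2) ^ 3 * c1 (square_snd v)"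
    by (rule odd_part_divisible[OF _ z(2)])
  moreover have "g = germ_of z" by (simp add: g z_def[abs_def])
  ultimately show "g \<in> odd_part_space 1 (\<lambda>_. True)"
    unfolding odd_part_space_def using z(1)
    by (intro CollectI exI[of _ z] exI[of _ c0] exI[of _ c1] conjI) simp_all
qed

section \<open>Construction of frontal deformations\<close>

text \<open>
  The hypotheses say \<open>dg\<^sub>2 = \<alpha>\<^sub>2 du\<^sub>1 + P u\<^sub>2 du\<^sub>2 + \<beta>\<^sub>2 dt\<close> and \<open>dg\<^sub>3 = \<alpha>\<^sub>3 du\<^sub>1 + Q u\<^sub>2 du\<^sub>2 + \<beta>\<^sub>3 dt\<close> with
  \<open>dg\<^sub>1 = du\<^sub>1\<close>: the differentials of all components are combinations of \<open>du\<^sub>1\<close>, \<open>u\<^sub>2 du\<^sub>2\<close> and \<open>dt\<close>. Eliminating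
  \<open>u\<^sub>2 du\<^sub>2\<close> gives \<open>P dg\<^sub>3 - Q dg\<^sub>2 + (Q \<alpha>\<^sub>2 - P \<alpha>\<^sub>3) dg\<^sub>1 + (Q \<beta>\<^sub>2 - P \<beta>\<^sub>3) dt = 0\<close>, a conormal form
  that does not vanish where \<open>P\<close> does not. Where \<open>u\<^sub>2\<close>, \<open>P\<close> and the Jacobian of \<open>(u\<^sub>1,u\<^sub>2)\<close> are nonzero the
  map is immersive, and the zeros of \<open>u\<^sub>2\<close> contain no open set since \<open>du\<^sub>2\<close> is nonzero.
\<close>

lemma frontal_germ_unfoldingI:
  fixes g :: "complex^(2 option) \<Rightarrow> complex^(3 option)" and u2 :: "complex^(2 option) \<Rightarrow> complex"
  defines "u1 \<equiv> \<lambda>w. g w $ Some 1"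
  assumes g0: "\<And>w. g w $ None = w $ None"
    and hg: "\<And>i. holo_fun_germ (\<lambda>w. g w $ i)"
    and h: "holo_fun_germ u2" "holo_fun_germ \<alpha>2" "holo_fun_germ \<alpha>3" "holo_fun_germ P" "holo_fun_germ Q"
      "holo_fun_germ \<beta>2" "holo_fun_germ \<beta>3"
    and d2: "\<forall>\<^sub>F w in nhds 0. \<forall>j. partial_deriv j (\<lambda>w. g w $ Some 2) w =
      \<alpha>2 w * partial_deriv j u1 w + u2 w * P w * partial_deriv j u2 w + (if j = None then \<beta>2 w else 0)"
    and d3: "\<forall>\<^sub>F w in nhds 0. \<forall>j. partial_deriv j (\<lambda>w. g w $ Some 3) w =
      \<alpha>3 w * partial_deriv j u1 w + u2 w * Q w * partial_deriv j u2 w + (if j = None then \<beta>3 w else 0)"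
    and P0: "P 0 \<noteq> 0"
    and jac: "partial_deriv (Some 1) u1 0 * partial_deriv (Some 2) u2 0 - partial_deriv (Some 2) u1 0 * partial_deriv (Some 1) u2 0 \<noteq> 0"
  shows "frontal_germ g"
proof -
  define J where "J w = partial_deriv (Some 1) u1 w * partial_deriv (Some 2) u2 w - partial_deriv (Some 2) u1 w * partial_deriv (Some 1) u2 w" for w
  define \<nu> :: "complex^(2 option) \<Rightarrow> complex^(3 option)" where
    "\<nu> w = (\<chi> i. case i of None \<Rightarrow> Q w * \<beta>2 w - P w * \<beta>3 w
       | Some k \<Rightarrow> (vector [Q w * \<alpha>2 w - P w * \<alpha>3 w, - Q w, P w] :: complex^3) $ k)" for w
  have \<nu>: "\<nu> w $ None = Q w * \<beta>2 w - P w * \<beta>3 w" "\<nu> w $ Some 1 = Q w * \<alpha>2 w - P w * \<alpha>3 w"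
    "\<nu> w $ Some 2 = - Q w" "\<nu> w $ Some 3 = P w" for w
    by (simp_all add: \<nu>_def)
  have hu1: "holo_fun_germ u1" unfolding u1_def by (rule hg)
  have hJ: "holo_fun_germ J" unfolding J_def by (intro holo_germ_diff holo_germ_mult holo_fun_germ_partial_deriv h hu1)
  have h\<nu>: "holo_fun_germ (\<lambda>w. \<nu> w $ i)" for i
  proof (cases i)
    case None
    then show ?thesis unfolding None \<nu> by (intro holo_germ_diff holo_germ_mult h)
  next
    case (Some k)
    show ?thesis unfolding Some using exhaust_3[of k]
      by (elim disjE; simp only: \<nu>; intro holo_germ_diff holo_germ_mult holo_germ_minus h)
  qed
  have ne: "\<forall>\<^sub>F w in nhds 0. k w \<noteq> 0" if "holo_fun_germ k" "k 0 \<noteq> 0" for k :: "complex^(2 option) \<Rightarrow> complex"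
  proof -
    have "isCont k 0" using eventually_nhds_x_imp_x[OF that(1)[unfolded holo_fun_germ_iff]] by (rule cdiff_continuous)
    then have "(k \<longlongrightarrow> k 0) (nhds 0)" by (simp add: isCont_def tendsto_at_iff_tendsto_nhds)
    then show ?thesis using that(2) by (rule tendsto_imp_eventually_ne)
  qed
  have "\<forall>\<^sub>F w in nhds 0. (\<forall>i. cdiff_at (\<lambda>w. g w $ i) w) \<and> (\<forall>i. cdiff_at (\<lambda>w. \<nu> w $ i) w) \<and> cdiff_at u2 w \<and> P w \<noteq> 0 \<and> J w \<noteq> 0
     \<and> (\<forall>j. partial_deriv j (\<lambda>w. g w $ Some 2) w =
      \<alpha>2 w * partial_deriv j u1 w + u2 w * P w * partial_deriv j u2 w + (if j = None then \<beta>2 w else 0)) \<and>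
     (\<forall>j. partial_deriv j (\<lambda>w. g w $ Some 3) w =
      \<alpha>3 w * partial_deriv j u1 w + u2 w * Q w * partial_deriv j u2 w + (if j = None then \<beta>3 w else 0))"
  proof -
    have "holo_map_germ g" "holo_map_germ \<nu>" using hg h\<nu> by (simp_all add: holo_map_germ_iff)
    then have "\<forall>\<^sub>F w in nhds 0. \<forall>i. cdiff_at (\<lambda>w. g w $ i) w" "\<forall>\<^sub>F w in nhds 0. \<forall>i. cdiff_at (\<lambda>w. \<nu> w $ i) w"
      unfolding holo_map_germ_def holo_map_def holo_fun_iff_cdiff eventually_nhds by blast+
    then show ?thesis
      using d2 d3 h(1) ne[OF h(4) P0] ne[OF hJ] jac unfolding holo_fun_germ_iff by (simp add: J_def eventually_conj_iff)
  qed
  then obtain U where U: "open U" "0 \<in> U"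
    and cg: "\<And>w i. w \<in> U \<Longrightarrow> cdiff_at (\<lambda>w. g w $ i) w"
    and c\<nu>: "\<And>w i. w \<in> U \<Longrightarrow> cdiff_at (\<lambda>w. \<nu> w $ i) w"
    and cu: "\<And>w. w \<in> U \<Longrightarrow> cdiff_at u2 w"
    and nz: "\<And>w. w \<in> U \<Longrightarrow> P w \<noteq> 0" "\<And>w. w \<in> U \<Longrightarrow> J w \<noteq> 0"
    and D2: "\<And>w j. w \<in> U \<Longrightarrow> partial_deriv j (\<lambda>w. g w $ Some 2) w =
      \<alpha>2 w * partial_deriv j u1 w + u2 w * P w * partial_deriv j u2 w + (if j = None then \<beta>2 w else 0)"
    and D3: "\<And>w j. w \<in> U \<Longrightarrow> partial_deriv j (\<lambda>w. g w $ Some 3) w =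
      \<alpha>3 w * partial_deriv j u1 w + u2 w * Q w * partial_deriv j u2 w + (if j = None then \<beta>3 w else 0)"
    unfolding eventually_nhds by blast
  have rel: "(\<Sum>i\<in>UNIV. \<nu> w $ i * partial_deriv j (\<lambda>w. g w $ i) w) = 0" if "w \<in> U" for w j
  proof -
    have "partial_deriv j (\<lambda>w. g w $ None) w = (if j = None then 1 else 0)" by (simp add: g0 partial_deriv_coord)
    then show ?thesis
      by (simp add: sum_UNIV_option sum_3 \<nu> D2[OF that] D3[OF that] u1_def[symmetric] algebra_simps)
  qed
  have fd: "frechet_derivative g (at w) v $ i = (\<Sum>j\<in>UNIV. partial_deriv j (\<lambda>w. g w $ i) w * v $ j)" if "w \<in> U" for w v i
    by (rule frechet_derivative_nth) (rule cg[OF that])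
  define D where "D = {w \<in> U. u2 w \<noteq> 0}"
  have "open D"
  proof -
    have "continuous_on U u2" by (intro continuous_at_imp_continuous_on ballI cdiff_continuous cu)
    then have "open (U \<inter> u2 -` (- {0}))" by (rule continuous_open_preimage[OF _ U(1)]) auto
    moreover have "U \<inter> u2 -` (- {0}) = D" by (auto simp: D_def)
    ultimately show ?thesis by simp
  qed
  moreover have "U \<subseteq> closure D"
  proof
    fix w assume w: "w \<in> U"
    show "w \<in> closure D"
    proof (rule ccontr)
      assume "w \<notin> closure D"
      then have "\<forall>\<^sub>F y in nhds w. y \<in> - closure D \<inter> U"
        by (intro eventually_nhds_in_open) (use U w in auto)
      then have "\<forall>\<^sub>F y in nhds w. u2 y = 0"
        by (rule eventually_mono) (use closure_subset[of D] in \<open>auto simp: D_def\<close>)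
      then have "partial_deriv j u2 w = 0" for j using partial_deriv_cong[of u2 "\<lambda>_. 0" w j] cu[OF w] by simp
      then show False using nz(2)[OF w] by (simp add: J_def)
    qed
  qed
  moreover have "inj (frechet_derivative g (at w))" if "w \<in> D" for w
  proof -
    from that have w: "w \<in> U" and s: "u2 w \<noteq> 0" by (auto simp: D_def)
    have lin: "linear (frechet_derivative g (at w))"
      using map_has_derivative[of g w, OF cg[OF w]] linear_frechet_derivative by (auto simp: differentiable_def)
    have "v = 0" if v: "frechet_derivative g (at w) v = 0" for v
    proof -
      define L where "L k = (\<Sum>j\<in>UNIV. partial_deriv j k w * v $ j)" for k :: "complex^(2 option) \<Rightarrow> complex"
      have f: "(\<Sum>j\<in>UNIV. partial_deriv j (\<lambda>w. g w $ i) w * v $ j) = 0" for i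
        using v fd[OF w, of v i] by simp
      have vN: "v $ None = 0" using f[of None] by (simp add: g0 partial_deriv_coord sum_UNIV_option)
      have L1: "L u1 = 0" using f[of "Some 1"] by (simp add: L_def u1_def)
      have "(\<Sum>j\<in>UNIV. partial_deriv j (\<lambda>w. g w $ Some 2) w * v $ j) = \<alpha>2 w * L u1 + u2 w * P w * L u2"
        unfolding D2[OF w] L_def using vN
        by (simp add: sum_UNIV_option sum_2 algebra_simps)
      then have "L u2 = 0" using f[of "Some 2"] L1 s nz(1)[OF w] by simp
      with L1 have e: "partial_deriv (Some 1) u1 w * v $ Some 1 + partial_deriv (Some 2) u1 w * v $ Some 2 = 0"
        "partial_deriv (Some 1) u2 w * v $ Some 1 + partial_deriv (Some 2) u2 w * v $ Some 2 = 0"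
        by (simp_all add: L_def sum_UNIV_option sum_2 vN)
      \<comment> \<open>Cramer's rule for the two equations in \<open>e\<close>.\<close>
      have "J w * v $ Some 1 = partial_deriv (Some 2) u2 w * (partial_deriv (Some 1) u1 w * v $ Some 1 + partial_deriv (Some 2) u1 w * v $ Some 2)
          - partial_deriv (Some 2) u1 w * (partial_deriv (Some 1) u2 w * v $ Some 1 + partial_deriv (Some 2) u2 w * v $ Some 2)"
        "J w * v $ Some 2 = partial_deriv (Some 1) u1 w * (partial_deriv (Some 1) u2 w * v $ Some 1 + partial_deriv (Some 2) u2 w * v $ Some 2)
          - partial_deriv (Some 1) u2 w * (partial_deriv (Some 1) u1 w * v $ Some 1 + partial_deriv (Some 2) u1 w * v $ Some 2)"
        by (simp_all add: J_def algebra_simps)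
      then have "J w * v $ Some 1 = 0" "J w * v $ Some 2 = 0" by (simp_all only: e mult_zero_right diff_zero)
      then have "v $ Some 1 = 0" "v $ Some 2 = 0" using nz(2)[OF w] by simp_all
      then show "v = 0" using vN by (simp add: vec_eq_iff forall_option forall_2)
    qed
    then show ?thesis using linear_injective_0[OF lin] by blast
  qed
  ultimately have "generically_immersive_on g U"
    unfolding generically_immersive_on_def D_def by blast
  moreover have "holo_map g U" "holo_map \<nu> U"
    using cg c\<nu> by (auto simp: holo_map_def holo_fun_iff_cdiff)
  moreover have "\<nu> w \<noteq> 0" if "w \<in> U" for w
    using nz(1)[OF that] \<nu>(4)[of w] by auto
  moreover have "(\<Sum>i\<in>UNIV. \<nu> w $ i * frechet_derivative g (at w) (\<xi> w) $ i) = 0" if "w \<in> U" for w \<xi>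
  proof -
    have "(\<Sum>i\<in>UNIV. \<nu> w $ i * frechet_derivative g (at w) (\<xi> w) $ i)
        = (\<Sum>j\<in>UNIV. (\<Sum>i\<in>UNIV. \<nu> w $ i * partial_deriv j (\<lambda>w. g w $ i) w) * \<xi> w $ j)"
      unfolding fd[OF that] sum_distrib_left sum_distrib_right
      by (subst sum.swap) (simp add: mult.assoc)
    then show ?thesis by (simp add: rel[OF that])
  qed
  ultimately show ?thesis unfolding frontal_germ_def frontal_on_def using U by blast
qed

lemma partial_deriv_pullback:
  fixes h :: "complex^2 \<Rightarrow> complex" and u1 u2 :: "complex^'n::finite \<Rightarrow> complex"
  assumes "holo_fun_germ h" "holo_fun_germ u1" "holo_fun_germ u2" "u1 0 = 0" "u2 0 = 0"
  shows "holo_fun_germ (\<lambda>w. h (vector [u1 w, u2 w]))"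
    and "\<forall>\<^sub>F w in nhds 0. \<forall>j. partial_deriv j (\<lambda>w. h (vector [u1 w, u2 w])) w =
      partial_deriv 1 h (vector [u1 w, u2 w]) * partial_deriv j u1 w + partial_deriv 2 h (vector [u1 w, u2 w]) * partial_deriv j u2 w"
proof -
  let ?u = "\<lambda>w. vector [u1 w, u2 w] :: complex^2"
  have 0: "?u 0 = 0" by (simp add: assms vec_eq_iff forall_2)
  have hu: "holo_fun_germ (\<lambda>w. ?u w $ j)" for j using exhaust_2[of j] assms by auto
  show "holo_fun_germ (\<lambda>w. h (?u w))" by (rule holo_germ_compose[where g = ?u, OF assms(1) hu 0])
  have "\<forall>\<^sub>F w in nhds 0. cdiff_at h (?u w)"
    by (rule eventually_compose_0[where g = ?u, OF assms(1)[unfolded holo_fun_germ_iff] isCont_map[OF hu] 0])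
  then show "\<forall>\<^sub>F w in nhds 0. \<forall>j. partial_deriv j (\<lambda>w. h (?u w)) w =
      partial_deriv 1 h (?u w) * partial_deriv j u1 w + partial_deriv 2 h (?u w) * partial_deriv j u2 w"
    using assms(2,3) unfolding holo_fun_germ_iff
  proof eventually_elim
    case (elim w)
    have c: "cdiff_at (\<lambda>w. ?u w $ j) w" for j using exhaust_2[of j] elim by auto
    show ?case by (subst partial_deriv_compose[where g = ?u, OF elim(1) c]) (simp add: sum_2)
  qed
qed

text \<open>
  The family is \<open>G_t = H_t \<circ> \<Phi>_t\<close> with \<open>\<Phi>_t = id + t (z1, \<kappa>)\<close> and \<open>H_t = (x, B2 + t a2, B3 + t a3)\<close>. All
  functions \<open>B2\<close>, \<open>B3\<close>, \<open>a2\<close>, \<open>a3\<close> have a \<open>y\<close>-derivative divisible by \<open>y\<close>, so after substituting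
  \<open>\<Phi>_t = (u\<^sub>1,u\<^sub>2)\<close> the differentials have the shape required by \<open>frontal_germ_unfoldingI\<close>. The velocity at
  \<open>t = 0\<close> is \<open>dH\<^sub>0(z1, \<kappa>) + (0, a2, a3)\<close>.
\<close>

lemma frontal_family:
  fixes z1 \<kappa> :: "complex^2 \<Rightarrow> complex"
  assumes h: "holo_fun_germ z1" "holo_fun_germ \<kappa>"
    and hB: "holo_fun_germ B2" "holo_fun_germ B3" and ha: "holo_fun_germ a2" "holo_fun_germ a3"
    and he: "holo_fun_germ e2" "holo_fun_germ e3" "holo_fun_germ w2" "holo_fun_germ w3"
    and dB: "\<forall>\<^sub>F v in nhds 0. partial_deriv 2 B2 v = v $ 2 * e2 v" "\<forall>\<^sub>F v in nhds 0. partial_deriv 2 B3 v = v $ 2 * e3 v"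
    and da: "\<forall>\<^sub>F v in nhds 0. partial_deriv 2 a2 v = v $ 2 * w2 v" "\<forall>\<^sub>F v in nhds 0. partial_deriv 2 a3 v = v $ 2 * w3 v"
    and e0: "e2 0 \<noteq> 0"
  defines "G \<equiv> \<lambda>t v. let u = vector [v $ 1 + t * z1 v, v $ 2 + t * \<kappa> v] :: complex^2
       in vector [u $ 1, B2 u + t * a2 u, B3 u + t * a3 u] :: complex^3"
  shows "frontal_germ (unfolding_map G)"
    and "\<forall>\<^sub>F v in nhds 0. (\<chi> i. deriv (\<lambda>t. G t v $ i) 0) =
      (vector [z1 v, partial_deriv 1 B2 v * z1 v + partial_deriv 2 B2 v * \<kappa> v + a2 v, partial_deriv 1 B3 v * z1 v + partial_deriv 2 B3 v * \<kappa> v + a3 v] :: complex^3)"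
proof -
  define u1 u2 :: "complex^(2 option) \<Rightarrow> complex" where
    "u1 w = w $ Some 1 + w $ None * z1 (drop_param w)" and "u2 w = w $ Some 2 + w $ None * \<kappa> (drop_param w)" for w
  define u where "u w = (vector [u1 w, u2 w] :: complex^2)" for w
  let ?g = "unfolding_map G"
  have g: "(\<lambda>w. ?g w $ Some 1) = u1" "(\<lambda>w. ?g w $ Some 2) = (\<lambda>w. B2 (u w) + w $ None * a2 (u w))"
      "(\<lambda>w. ?g w $ Some 3) = (\<lambda>w. B3 (u w) + w $ None * a3 (u w))"
    by (simp_all add: fun_eq_iff unfolding_map_Some G_def Let_def u_def u1_def u2_def)
  have hu: "holo_fun_germ u1" "holo_fun_germ u2"
    unfolding u1_def u2_def by (intro holo_germ_add holo_germ_mult holo_germ_coord holo_germ_drop_param h)+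
  have u0: "u1 0 = 0" "u2 0 = 0" "u 0 = 0" by (simp_all add: u1_def u2_def u_def vec_eq_iff forall_2)
  have hu': "holo_fun_germ (\<lambda>w. k (u w))" if "holo_fun_germ k" for k
    unfolding u_def by (rule partial_deriv_pullback(1)[OF that hu u0(1,2)])
  have cont: "isCont u 0"
  proof (rule isCont_map)
    show "holo_fun_germ (\<lambda>w. u w $ j)" for j
      using exhaust_2[of j] hu by (auto simp: u_def)
  qed
  have du: "\<forall>\<^sub>F w in nhds 0. \<forall>j. partial_deriv j u1 w = (if j = Some 1 then 1 else 0) + w $ None * partial_deriv j (\<lambda>w. z1 (drop_param w)) w
        + (if j = None then z1 (drop_param w) else 0) \<and>
      partial_deriv j u2 w = (if j = Some 2 then 1 else 0) + w $ None * partial_deriv j (\<lambda>w. \<kappa> (drop_param w)) w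
        + (if j = None then \<kappa> (drop_param w) else 0)"
    unfolding u1_def[abs_def] u2_def[abs_def]
    using holo_germ_drop_param[OF h(1), unfolded holo_fun_germ_iff] holo_germ_drop_param[OF h(2), unfolded holo_fun_germ_iff]
    by eventually_elim (simp add: partial_deriv_add partial_deriv_mult partial_deriv_coord)
  have dg: "\<forall>\<^sub>F w in nhds 0. \<forall>j. partial_deriv j (\<lambda>w. B (u w) + w $ None * a (u w)) w =
      (partial_deriv 1 B (u w) + w $ None * partial_deriv 1 a (u w)) * partial_deriv j u1 w + (partial_deriv 2 B (u w) + w $ None * partial_deriv 2 a (u w)) * partial_deriv j u2 w
      + (if j = None then a (u w) else 0)"
    if Ba: "holo_fun_germ B" "holo_fun_germ a" for B a
    using partial_deriv_pullback(2)[OF Ba(1) hu u0(1,2), folded u_def] partial_deriv_pullback(2)[OF Ba(2) hu u0(1,2), folded u_def]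
      hu'[OF Ba(1), unfolded holo_fun_germ_iff] hu'[OF Ba(2), unfolded holo_fun_germ_iff]
  proof (eventually_elim, intro allI)
    case (elim w)
    fix j
    have "cdiff_at (\<lambda>w. w $ None * a (u w)) w" using elim(4) by simp
    then show "partial_deriv j (\<lambda>w. B (u w) + w $ None * a (u w)) w =
      (partial_deriv 1 B (u w) + w $ None * partial_deriv 1 a (u w)) * partial_deriv j u1 w + (partial_deriv 2 B (u w) + w $ None * partial_deriv 2 a (u w)) * partial_deriv j u2 w
      + (if j = None then a (u w) else 0)"
      using elim by (simp add: partial_deriv_add partial_deriv_mult partial_deriv_coord algebra_simps)
  qed
  have dg': "\<forall>\<^sub>F w in nhds 0. \<forall>j. partial_deriv j (\<lambda>w. B (u w) + w $ None * a (u w)) w =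
      (partial_deriv 1 B (u w) + w $ None * partial_deriv 1 a (u w)) * partial_deriv j u1 w + u2 w * (e (u w) + w $ None * \<omega> (u w)) * partial_deriv j u2 w
      + (if j = None then a (u w) else 0)"
    if "holo_fun_germ B" "holo_fun_germ a" and "\<forall>\<^sub>F v in nhds 0. partial_deriv 2 B v = v $ 2 * e v"
      "\<forall>\<^sub>F v in nhds 0. partial_deriv 2 a v = v $ 2 * \<omega> v" for B a e \<omega>
    using dg[OF that(1,2)] eventually_compose_0[where g = u, OF that(3) cont u0(3)]
      eventually_compose_0[where g = u, OF that(4) cont u0(3)]
    by eventually_elim (simp add: u_def algebra_simps)
  show "frontal_germ ?g"
  proof (rule frontal_germ_unfoldingI[where ?u2.0 = u2])
    show "holo_fun_germ (\<lambda>w. ?g w $ i)" for i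
    proof (cases i)
      case None
      then show ?thesis by (simp add: holo_germ_coord)
    next
      case (Some k)
      then show ?thesis using exhaust_3[of k] g hu(1)
        by (auto intro!: holo_germ_add holo_germ_mult holo_germ_coord hu' hB ha)
    qed
    show "\<forall>\<^sub>F w in nhds 0. \<forall>j. partial_deriv j (\<lambda>w. ?g w $ Some 2) w =
      (partial_deriv 1 B2 (u w) + w $ None * partial_deriv 1 a2 (u w)) * partial_deriv j (\<lambda>w. ?g w $ Some 1) w
      + u2 w * (e2 (u w) + w $ None * w2 (u w)) * partial_deriv j u2 w + (if j = None then a2 (u w) else 0)"
      unfolding g by (rule dg'[OF hB(1) ha(1) dB(1) da(1)])
    show "\<forall>\<^sub>F w in nhds 0. \<forall>j. partial_deriv j (\<lambda>w. ?g w $ Some 3) w =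
      (partial_deriv 1 B3 (u w) + w $ None * partial_deriv 1 a3 (u w)) * partial_deriv j (\<lambda>w. ?g w $ Some 1) w
      + u2 w * (e3 (u w) + w $ None * w3 (u w)) * partial_deriv j u2 w + (if j = None then a3 (u w) else 0)"
      unfolding g by (rule dg'[OF hB(2) ha(2) dB(2) da(2)])
    show "partial_deriv (Some 1) (\<lambda>w. ?g w $ Some 1) 0 * partial_deriv (Some 2) u2 0 - partial_deriv (Some 2) (\<lambda>w. ?g w $ Some 1) 0 * partial_deriv (Some 1) u2 0 \<noteq> 0"
      unfolding g using eventually_nhds_x_imp_x[OF du] by simp
  qed (use e0 u0 in \<open>auto intro!: holo_germ_add holo_germ_mult holo_germ_coord hu' hB ha he holo_fun_germ_partial_deriv hu\<close>)
  have uS: "u (zero_slice v) = v" for v by (simp add: u_def u1_def u2_def vec_eq_iff forall_2)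
  have hg: "holo_fun_germ (\<lambda>w. B2 (u w) + w $ None * a2 (u w))" "holo_fun_germ (\<lambda>w. B3 (u w) + w $ None * a3 (u w))"
    by (intro holo_germ_add holo_germ_mult holo_germ_coord hu' hB ha)+
  show "\<forall>\<^sub>F v in nhds 0. (\<chi> i. deriv (\<lambda>t. G t v $ i) 0) =
      (vector [z1 v, partial_deriv 1 B2 v * z1 v + partial_deriv 2 B2 v * \<kappa> v + a2 v, partial_deriv 1 B3 v * z1 v + partial_deriv 2 B3 v * \<kappa> v + a3 v] :: complex^3)"
    using eventually_slice[OF du] eventually_slice[OF dg[OF hB(1) ha(1)]] eventually_slice[OF dg[OF hB(2) ha(2)]]
      eventually_slice[OF hu(1)[unfolded holo_fun_germ_iff]] eventually_slice[OF hg(1)[unfolded holo_fun_germ_iff]]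
      eventually_slice[OF hg(2)[unfolded holo_fun_germ_iff]]
  proof eventually_elim
    case (elim v)
    have "cdiff_at (\<lambda>w. ?g w $ Some i) (zero_slice v)" for i
      using exhaust_3[of i] elim(4-6) by (auto simp: g)
    then have d: "deriv (\<lambda>t. G t v $ i) 0 = partial_deriv None (\<lambda>w. ?g w $ Some i) (zero_slice v)" for i
      by (rule deriv_eq_partial_deriv_None)
    have u12: "partial_deriv None u1 (zero_slice v) = z1 v" "partial_deriv None u2 (zero_slice v) = \<kappa> v" using elim(1) by simp_all
    show ?case unfolding vector3_eq_iff using elim(2,3)
      by (simp add: d g u12 uS)
  qed
qed

text \<open>
  Given the field \<open>z\<close>, the family with \<open>H\<^sub>0 = f\<^sub>1\<close> and \<open>(a2, a3)\<close> the last two components of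
  \<open>z - df\<^sub>1(z\<^sub>1, \<kappa>)\<close> has velocity \<open>z\<close>; what has to be arranged is that the \<open>y\<close>-derivatives of \<open>a2\<close> and
  \<open>a3\<close> are divisible by \<open>y\<close>. The choice \<open>\<kappa> = (\<partial>z\<^sub>2/\<partial>y) / 2\<close> makes \<open>a2 = z\<^sub>2 - 2 y \<kappa>\<close> have
  \<open>y\<close>-derivative \<open>- y \<partial>\<^sup>2z\<^sub>2/\<partial>y\<^sup>2\<close>. In \<open>a3\<close> every term except the even part of \<open>z\<^sub>3\<close> contains \<open>y^2\<close>, because the
  odd part of \<open>z\<^sub>3\<close> is divisible by \<open>y^3\<close>.
\<close>

lemma frontal_deformations_superset:
  assumes p: "holo_fun_germ p"
  shows "odd_part_space 1 (\<lambda>_. True) \<subseteq> frontal_deformations (fold_map 1 p)"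
proof
  fix g assume "g \<in> odd_part_space 1 (\<lambda>_. True)"
  then obtain z c0 c1 where g: "g = germ_of z" and z: "\<And>i. holo_fun_germ (\<lambda>v. z v $ i)"
    and c: "holo_fun_germ c0" "holo_fun_germ c1"
    and z3: "\<forall>\<^sub>F v in nhds 0. z v $ 3 = c0 (square_snd v) + (v $ 2) ^ 3 * c1 (square_snd v)"
    by (auto simp: odd_part_space_def holo_map_germ_iff numeral_3_eq_3)
  define z1 z2 where "z1 v = z v $ 1" and "z2 v = z v $ 2" for v
  have hz: "holo_fun_germ z1" "holo_fun_germ z2" unfolding z1_def z2_def by (rule z)+
  define \<kappa> where "\<kappa> v = partial_deriv 2 z2 v / 2" for v
  have h\<kappa>: "holo_fun_germ \<kappa>" unfolding \<kappa>_def by (intro holo_germ_divide_const holo_fun_germ_partial_deriv hz)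
  note hsq = holo_germ_square_snd
  have hy: "holo_fun_germ (\<lambda>v :: complex^2. v $ 2)" by (rule holo_germ_coord)
  note H = holo_germ_add holo_germ_diff holo_germ_mult holo_germ_minus hy holo_germ_const
  define B2 where "B2 v = (v $ 2)\<^sup>2" for v :: "complex^2"
  define B3 where "B3 v = (v $ 2) ^ 3 * p (square_snd v)" for v
  define e3 where "e3 v = 3 * v $ 2 * p (square_snd v) + 2 * (v $ 2) ^ 3 * partial_deriv 2 p (square_snd v)" for v
  define a2 where "a2 v = z2 v - v $ 2 * partial_deriv 2 z2 v" for v
  define w2 where "w2 v = - partial_deriv 2 (partial_deriv 2 z2) v" for v
  define S where "S v = v $ 2 * c1 (square_snd v) - v $ 2 * partial_deriv 1 p (square_snd v) * z1 v - (3 * p (square_snd v) + 2 * (v $ 2)\<^sup>2 * partial_deriv 2 p (square_snd v)) * \<kappa> v" for v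
  define a3 where "a3 v = c0 (square_snd v) + (v $ 2)\<^sup>2 * S v" for v
  define w3 where "w3 v = 2 * partial_deriv 2 c0 (square_snd v) + 2 * S v + v $ 2 * partial_deriv 2 S v" for v
  have hp: "holo_fun_germ (\<lambda>v. p (square_snd v))" "holo_fun_germ (\<lambda>v. partial_deriv 1 p (square_snd v))" "holo_fun_germ (\<lambda>v. partial_deriv 2 p (square_snd v))"
    "holo_fun_germ (\<lambda>v. c0 (square_snd v))" "holo_fun_germ (\<lambda>v. c1 (square_snd v))" "holo_fun_germ (\<lambda>v. partial_deriv 2 c0 (square_snd v))"
    by (intro hsq p c holo_fun_germ_partial_deriv)+
  have hS: "holo_fun_germ S" unfolding S_def by (intro H hp hz h\<kappa> holo_germ_power)
  have cp: "\<forall>\<^sub>F v in nhds 0. cdiff_at p (square_snd v)" using eventually_square_snd[OF p[unfolded holo_fun_germ_iff]] .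
  have cc: "\<forall>\<^sub>F v in nhds 0. cdiff_at c0 (square_snd v)" using eventually_square_snd[OF c(1)[unfolded holo_fun_germ_iff]] .
  have pw: "partial_deriv 2 (\<lambda>w :: complex^2. (w $ 2) ^ Suc m) v = of_nat (Suc m) * (v $ 2) ^ m" for m v
    using partial_deriv_power[of "\<lambda>w. w $ 2" v 2 m] by (simp add: partial_deriv_coord)
  have pw2: "partial_deriv 2 (\<lambda>w :: complex^2. (w $ 2)\<^sup>2) v = 2 * v $ 2" and pw3: "partial_deriv 2 (\<lambda>w :: complex^2. (w $ 2) ^ 3) v = 3 * (v $ 2)\<^sup>2" for v
    using pw[of 1 v] pw[of 2 v] by (simp_all add: numeral_2_eq_2 numeral_3_eq_3)
  have pw1: "partial_deriv 1 (\<lambda>w :: complex^2. (w $ 2) ^ Suc m) v = 0" for m v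
    using partial_deriv_power[of "\<lambda>w. w $ 2" v 1 m] by (simp add: partial_deriv_coord)
  have pw12: "partial_deriv 1 (\<lambda>w :: complex^2. (w $ 2)\<^sup>2) v = 0" and pw13: "partial_deriv 1 (\<lambda>w :: complex^2. (w $ 2) ^ 3) v = 0" for v
    using pw1[of 1 v] pw1[of 2 v] by (simp_all add: numeral_2_eq_2 numeral_3_eq_3)
  have dB3: "\<forall>\<^sub>F v in nhds 0. partial_deriv 1 B3 v = (v $ 2) ^ 3 * partial_deriv 1 p (square_snd v) \<and> partial_deriv 2 B3 v = v $ 2 * e3 v"
    using cp
  proof eventually_elim
    case (elim v)
    note q = partial_deriv_square_snd[OF elim]
    show ?case
      unfolding B3_def[abs_def] e3_def
      by (simp only: partial_deriv_mult[OF cdiff_power[OF cdiff_coord] q(1)] q(2,3) pw3 pw13)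
         (simp add: algebra_simps power3_eq_cube power2_eq_square)
  qed
  have da3: "\<forall>\<^sub>F v in nhds 0. partial_deriv 2 a3 v = v $ 2 * w3 v"
    using cc hS[unfolded holo_fun_germ_iff]
  proof eventually_elim
    case (elim v)
    note q = partial_deriv_square_snd[OF elim(1)]
    have m: "cdiff_at (\<lambda>v. (v $ 2)\<^sup>2 * S v) v" using elim(2) by simp
    show ?case
      unfolding a3_def[abs_def] w3_def
      by (simp only: partial_deriv_add[OF q(1) m] partial_deriv_mult[OF cdiff_power[OF cdiff_coord] elim(2)] q(3) pw2)
         (simp add: algebra_simps power2_eq_square)
  qed
  have da2: "\<forall>\<^sub>F v in nhds 0. partial_deriv 2 a2 v = v $ 2 * w2 v"
    using hz(2)[unfolded holo_fun_germ_iff] holo_fun_germ_partial_deriv[OF hz(2), of 2, unfolded holo_fun_germ_iff]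
    by eventually_elim (simp add: a2_def[abs_def] w2_def partial_deriv_diff partial_deriv_mult partial_deriv_coord)
  define G where "G = (\<lambda>t v. let u = vector [v $ 1 + t * z1 v, v $ 2 + t * \<kappa> v] :: complex^2
       in vector [u $ 1, B2 u + t * a2 u, B3 u + t * a3 u] :: complex^3)"
  have "holo_fun_germ B2" "holo_fun_germ B3" "holo_fun_germ a2" "holo_fun_germ a3" 
    "holo_fun_germ e3" "holo_fun_germ w2" "holo_fun_germ w3"
    unfolding B2_def B3_def a2_def a3_def e3_def w2_def w3_def
    by (intro H hp hz holo_germ_power holo_fun_germ_partial_deriv hS)+
  moreover have "holo_fun_germ (\<lambda>_ :: complex^2. 2)" by (rule holo_germ_const)
  moreover have "\<forall>\<^sub>F v in nhds 0. partial_deriv 2 B2 v = v $ 2 * 2" by (simp add: B2_def[abs_def] pw2)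
  moreover have "\<forall>\<^sub>F v in nhds 0. partial_deriv 2 B3 v = v $ 2 * e3 v" using dB3 by (rule eventually_mono) simp
  ultimately have fam: "frontal_germ (unfolding_map G)"
    "\<forall>\<^sub>F v in nhds 0. (\<chi> i. deriv (\<lambda>t. G t v $ i) 0) =
      (vector [z1 v, partial_deriv 1 B2 v * z1 v + partial_deriv 2 B2 v * \<kappa> v + a2 v, partial_deriv 1 B3 v * z1 v + partial_deriv 2 B3 v * \<kappa> v + a3 v] :: complex^3)"
    unfolding G_def
    using frontal_family[OF hz(1) h\<kappa>, of B2 B3 a2 a3 "\<lambda>_. 2" e3 w2 w3] da2 da3 by simp_all
  have "vector [v $ 1, v $ 2] = v" for v :: "complex^2" by (simp add: vec_eq_iff forall_2)
  then have "\<forall>\<^sub>F v in nhds 0. G 0 v = fold_map 1 p v"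
    by (simp add: G_def B2_def B3_def vector3_eq_iff numeral_3_eq_3)
  moreover have "g = germ_of (\<lambda>v. \<chi> i. deriv (\<lambda>t. G t v $ i) 0)"
    unfolding g germ_of_eq_iff using fam(2) z3 dB3
  proof eventually_elim
    case (elim v)
    have "z1 v = z v $ 1" by (simp add: z1_def)
    moreover have "partial_deriv 1 B2 v * z1 v + partial_deriv 2 B2 v * \<kappa> v + a2 v = z v $ 2"
      by (simp add: B2_def[abs_def] pw2 pw12 a2_def \<kappa>_def) (simp add: z2_def)
    moreover have "partial_deriv 1 B3 v * z1 v + partial_deriv 2 B3 v * \<kappa> v + a3 v = z v $ 3"
      using elim(2,3) by (simp add: a3_def S_def e3_def algebra_simps power3_eq_cube power2_eq_square)
    ultimately show ?case unfolding elim(1) by (simp add: vector3_eq_iff)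
  qed
  ultimately show "g \<in> frontal_deformations (fold_map 1 p)"
    unfolding frontal_deformations_def using fam(1) by blast
qed

section \<open>The isomorphism\<close>

theorem theorem3p7:
  fixes p :: "complex^2 \<Rightarrow> complex"
  assumes "holo_fun_germ p"
  shows "isomorphic_spaces complex_field
           (A_quotient (fold_surface p)) (F_quotient (fold_frontalisation p))
       \<and> (A_finite (fold_surface p) \<longleftrightarrow> F_finite (fold_frontalisation p))
       \<and> codim_A (fold_surface p) = codim_F (fold_frontalisation p)"
proof -
  let ?C = "odd_part_space 0 (\<lambda>_. True)" and ?W = "odd_part_space 0 (fold_ideal p)"
  have TA: "TAe (fold_map k p) = odd_part_space k (fold_ideal p)" for k
    using TAe_fold_map_subset[OF assms] TAe_fold_map_superset[OF assms] by blast
  have F: "frontal_deformations (fold_map 1 p) = twist_odd_part ` ?C"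
    using frontal_deformations_subset[OF assms] frontal_deformations_superset[OF assms]
    by (simp add: twist_odd_part_odd_part_space)
  have A: "A_quotient (fold_surface p) = quotient_space (germ_space ?C) ?W"
    unfolding A_quotient_def fold_surface_eq TA theta_eq_odd_part_space ..
  have B: "F_quotient (fold_frontalisation p) = quotient_space (germ_space (twist_odd_part ` ?C)) (twist_odd_part ` ?W)"
    unfolding F_quotient_def fold_frontalisation_eq TA F twist_odd_part_odd_part_space theta_eq_odd_part_space
    by (simp add: germ_space_def)
  have iso: "isomorphic_spaces complex_field (A_quotient (fold_surface p)) (F_quotient (fold_frontalisation p))"
    unfolding A B
  proof (rule isomorphic_quotients(2)[OF _ germ_subspace_fold_ideal _ twist_odd_part_add twist_odd_part_scale])
    show "germ_subspace ?C" by (rule germ_subspace_odd_part_space) simp_all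
    show "?W \<subseteq> ?C" by (auto simp: odd_part_space_def)
    show "inj_on twist_odd_part ?C" using inj_twist_odd_part by (rule inj_on_subset) simp
  qed
  have "codim_A (fold_surface p) = codim_F (fold_frontalisation p)"
    unfolding codim_A_def codim_F_def by (rule dim_ext_eq_of_isomorphic[OF iso])
  with iso show ?thesis by (simp add: A_finite_def F_finite_def)
qed

end
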